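(* Let $G$ be a finite group of even order $n$, let $C$ be a cyclic group of the same order $n$, and let $\alpha: \Omega(C) \to \Omega(G)$ be the Frobenius–Wielandt homomorphism. If $G$ is $2$-seminilpotent, then $$\alpha(\Omega(C)^\times) \subseteq \Omega(G, \mathrm{NS}(G))^\times,$$ where $\mathrm{NS}(G)$ is the set of all normal subgroups of $G$. In particular, $$\alpha(\Omega(C)^\times) = \Big\langle -1_{\Omega(G)},\ \prod_{\{N \leq G \,:\, |G:N| = 2\}} u_N \Big\rangle,$$ where $u_N = 1_{\Omega(G)} - [G/N]$.
   Context: For a finite group $G$, the Burnside ring $\Omega(G)$ is the Grothendieck ring of the semiring of isomorphism classes of finite left $G$-sets, with addition given by disjoint union and multiplication by Cartesian product. It is a free abelian group with basis the classes $[G/H]$, where $H$ runs over representatives of the conjugacy classes of subgroups of $G$, and $1_{\Omega(G)} = [G/G]$. For a family $\mathcal{D}$ of subgroups of $G$ containing $G$ and closed under $G$-conjugation and intersection, $\Omega(G,\mathcal{D})$ is the $\mathbb{Z}$-span of $\{[G/H] \mid H \in \mathcal{D}\}$ in $\Omega(G)$, a unital subring. $R^\times$ denotes the group of units of a ring $R$. For $K \leq G$, $\varphi^G_K: \Omega(G) \to \mathbb{Z}$ is the ring homomorphism induced by sending a finite $G$-set $X$ to the number of points of $X$ fixed by $K$; the product $(\varphi^G_K)_K$ over conjugacy classes of subgroups $K$ is injective. Frobenius–Wielandt homomorphism: for a finite group $G$ and a cyclic group $C$ of order $|G|$, it is the ring homomorphism $\alpha: \Omega(C) \to \Omega(G)$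 determined by $\varphi^G_K(\alpha(x)) = \varphi^C_{C_{|K|}}(x)$ for every subgroup $K$ of $G$ and every $x\in\Omega(C)$, where $C_{|K|}$ is the unique subgroup of $C$ of order $|K|$ (such an $\alpha$ is known to exist). Definition: for a prime $p$ and a positive integer $a$, a finite group $G$ is $p^a$-seminilpotent if for every subgroup $K$ of $G$ whose index is divisible by $p^a$, there exists a normal subgroup $N$ of $G$ with $K \leq N$ and $|G:N| = p^a$, and $\#\{N \trianglelefteq G \mid K \leq N,\ |G:N| = p^a\} \equiv 1 \pmod p$. "$2$-seminilpotent" is the case $p=2$, $a=1$. *)

theory Defs
  imports "HOL-Number_Theory.Cong" "HOL-Algebra.Ring" "HOL-Algebra.Elementary_Groups"
    "HOL-Algebra.Group_Action" "HOL-Algebra.Left_Coset"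
begin

text \<open>A \<open>G\<close>-set is a pair \<open>(X, \<phi>)\<close> of an underlying set and a left action. The library's
  \<^const>\<open>group_action\<close> makes every \<open>\<phi> g\<close> extensional on \<open>X\<close>, hence the restrictions
  \<open>\<lambda>x\<in>X. _\<close> in the constructions below.\<close>

type_synonym ('a, 'x) gset = "'x set \<times> ('a \<Rightarrow> 'x \<Rightarrow> 'x)"

definition finite_gset :: "('a, 'm) monoid_scheme \<Rightarrow> ('a, 'x) gset \<Rightarrow> bool" where
  "finite_gset G X \<longleftrightarrow> finite (fst X) \<and> group_action G (fst X) (snd X)"

definition gset_iso :: "('a, 'm) monoid_scheme \<Rightarrow> ('a, 'x) gset \<Rightarrow> ('a, 'y) gset \<Rightarrow> bool" where
  "gset_iso G X Y \<longleftrightarrow>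
     (\<exists>f. bij_betw f (fst X) (fst Y) \<and>
          (\<forall>g\<in>carrier G. \<forall>x\<in>fst X. f (snd X g x) = snd Y g (f x)))"

definition gset_sum :: "('a, 'x) gset \<Rightarrow> ('a, 'y) gset \<Rightarrow> ('a, 'x + 'y) gset" where
  "gset_sum X Y =
     (fst X <+> fst Y, \<lambda>g. \<lambda>z\<in>fst X <+> fst Y. map_sum (snd X g) (snd Y g) z)"

definition gset_prod :: "('a, 'x) gset \<Rightarrow> ('a, 'y) gset \<Rightarrow> ('a, 'x \<times> 'y) gset" where
  "gset_prod X Y =
     (fst X \<times> fst Y, \<lambda>g. \<lambda>z\<in>fst X \<times> fst Y. map_prod (snd X g) (snd Y g) z)"

definition empty_gset :: "('a, 'x) gset" where
  "empty_gset = ({}, \<lambda>g. \<lambda>x\<in>{}. x)"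

definition coset_gset :: "('a, 'm) monoid_scheme \<Rightarrow> 'a set \<Rightarrow> ('a, 'a set) gset" where
  "coset_gset G H =
     (lcosets\<^bsub>G\<^esub> H, \<lambda>g. \<lambda>A\<in>lcosets\<^bsub>G\<^esub> H. g <#\<^bsub>G\<^esub> A)"

definition fixed_points :: "'a set \<Rightarrow> ('a, 'x) gset \<Rightarrow> 'x set" where
  "fixed_points K X = {x \<in> fst X. \<forall>k\<in>K. snd X k x = x}"

text \<open>Every finite \<open>G\<close>-set, over any type, is isomorphic to one whose underlying set consists of
  natural numbers. So the isomorphism class of \<open>X\<close> is represented by the set of all finite
  \<open>G\<close>-sets on sets of natural numbers that are isomorphic to \<open>X\<close>; it is nonempty and
  two finite \<open>G\<close>-sets have the same class iff they are isomorphic.\<close>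

type_synonym 'a gset_class = "('a, nat) gset set"

definition iso_class :: "('a, 'm) monoid_scheme \<Rightarrow> ('a, 'x) gset \<Rightarrow> 'a gset_class" where
  "iso_class G X = {Y. finite_gset G Y \<and> gset_iso G X Y}"

definition gset_semiring :: "('a, 'm) monoid_scheme \<Rightarrow> 'a gset_class ring" where
  "gset_semiring G =
     \<lparr>carrier = {iso_class G X | X :: ('a, nat) gset. finite_gset G X},
      mult = (\<lambda>A B. \<Union>X\<in>A. \<Union>Y\<in>B. iso_class G (gset_prod X Y)),
      one = iso_class G (coset_gset G (carrier G)),
      zero = iso_class G (empty_gset :: ('a, nat) gset),
      add = (\<lambda>A B. \<Union>X\<in>A. \<Union>Y\<in>B. iso_class G (gset_sum X Y))\<rparr>"

text \<open>The Grothendieck ring of a commutative semiring: formal differences \<open>a - b\<close>, represented by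
  pairs \<open>(a, b)\<close>. Cancellation is not assumed in the semiring, hence the extra summand \<open>e\<close>.\<close>

definition groth_rel :: "('s, 'k) ring_scheme \<Rightarrow> (('s \<times> 's) \<times> ('s \<times> 's)) set" where
  "groth_rel S =
     {((a, b), (c, d)) | a b c d.
        a \<in> carrier S \<and> b \<in> carrier S \<and> c \<in> carrier S \<and> d \<in> carrier S \<and>
        (\<exists>e\<in>carrier S. a \<oplus>\<^bsub>S\<^esub> d \<oplus>\<^bsub>S\<^esub> e = c \<oplus>\<^bsub>S\<^esub> b \<oplus>\<^bsub>S\<^esub> e)}"

definition groth_class :: "('s, 'k) ring_scheme \<Rightarrow> 's \<Rightarrow> 's \<Rightarrow> ('s \<times> 's) set" where
  "groth_class S a b = groth_rel S `` {(a, b)}"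

definition grothendieck_ring :: "('s, 'k) ring_scheme \<Rightarrow> ('s \<times> 's) set ring" where
  "grothendieck_ring S =
     \<lparr>carrier = (carrier S \<times> carrier S) // groth_rel S,
      mult = (\<lambda>x y. \<Union>(a, b)\<in>x. \<Union>(c, d)\<in>y.
        groth_class S (a \<otimes>\<^bsub>S\<^esub> c \<oplus>\<^bsub>S\<^esub> b \<otimes>\<^bsub>S\<^esub> d) (a \<otimes>\<^bsub>S\<^esub> d \<oplus>\<^bsub>S\<^esub> b \<otimes>\<^bsub>S\<^esub> c)),
      one = groth_class S \<one>\<^bsub>S\<^esub> \<zero>\<^bsub>S\<^esub>,
      zero = groth_class S \<zero>\<^bsub>S\<^esub> \<zero>\<^bsub>S\<^esub>,
      add = (\<lambda>x y. \<Union>(a, b)\<in>x. \<Union>(c, d)\<in>y. groth_class S (a \<oplus>\<^bsub>S\<^esub> c) (b \<oplus>\<^bsub>S\<^esub> d))\<rparr>"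

type_synonym 'a burnside = "('a gset_class \<times> 'a gset_class) set"

definition burnside_ring :: "('a, 'm) monoid_scheme \<Rightarrow> 'a burnside ring" where
  "burnside_ring G = grothendieck_ring (gset_semiring G)"

definition burnside_class :: "('a, 'm) monoid_scheme \<Rightarrow> ('a, 'x) gset \<Rightarrow> 'a burnside" where
  "burnside_class G X =
     groth_class (gset_semiring G) (iso_class G X) \<zero>\<^bsub>gset_semiring G\<^esub>"

text \<open>The \<open>\<int>\<close>-span of the classes \<open>[G/H]\<close>, \<open>H \<in> \<D>\<close>, i.e. the additive subgroup they generate.
  It is a unital subring if \<open>\<D>\<close> contains \<open>G\<close> and is closed under conjugation and
  intersection.\<close>

definition burnside_subring :: "('a, 'm) monoid_scheme \<Rightarrow> 'a set set \<Rightarrow> 'a burnside ring" where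
  "burnside_subring G \<D> =
     (burnside_ring G)
       \<lparr>carrier := generate (add_monoid (burnside_ring G))
          {burnside_class G (coset_gset G H) | H. H \<in> \<D>}\<rparr>"

text \<open>The value at a formal difference \<open>[X] - [Y]\<close> is \<open>|X\<^sup>K| - |Y\<^sup>K|\<close>,
  which does not depend on the choices.\<close>

definition mark :: "('a, 'm) monoid_scheme \<Rightarrow> 'a set \<Rightarrow> 'a burnside \<Rightarrow> int" where
  "mark G K x =
     the_elem {int (card (fixed_points K X)) - int (card (fixed_points K Y)) | X Y.
       \<exists>A B. (A, B) \<in> x \<and> X \<in> A \<and> Y \<in> B}"

definition subgroup_of_order :: "('a, 'm) monoid_scheme \<Rightarrow> nat \<Rightarrow> 'a set" where
  "subgroup_of_order C k = (THE H. subgroup H C \<and> card H = k)"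

definition frobenius_wielandt ::
  "('b, 'n) monoid_scheme \<Rightarrow> ('a, 'm) monoid_scheme \<Rightarrow> ('b burnside \<Rightarrow> 'a burnside) \<Rightarrow> bool" where
  "frobenius_wielandt C G \<alpha> \<longleftrightarrow>
     \<alpha> \<in> ring_hom (burnside_ring C) (burnside_ring G) \<and>
     (\<forall>K x. subgroup K G \<longrightarrow> x \<in> carrier (burnside_ring C) \<longrightarrow>
        mark G K (\<alpha> x) = mark C (subgroup_of_order C (card K)) x)"

definition subgroup_index :: "('a, 'm) monoid_scheme \<Rightarrow> 'a set \<Rightarrow> nat" where
  "subgroup_index G H = card (rcosets\<^bsub>G\<^esub> H)"

text \<open>Meant for a finite group \<open>G\<close>, a prime \<open>p\<close> and \<open>a > 0\<close>.\<close>

definition seminilpotent :: "nat \<Rightarrow> nat \<Rightarrow> ('a, 'm) monoid_scheme \<Rightarrow> bool" where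
  "seminilpotent p a G \<longleftrightarrow>
     (\<forall>K. subgroup K G \<and> p ^ a dvd subgroup_index G K \<longrightarrow>
        (\<exists>N. N \<lhd> G \<and> K \<subseteq> N \<and> subgroup_index G N = p ^ a) \<and>
        [card {N. N \<lhd> G \<and> K \<subseteq> N \<and> subgroup_index G N = p ^ a} = 1] (mod p))"

definition normal_subgroups :: "('a, 'm) monoid_scheme \<Rightarrow> 'a set set" where
  "normal_subgroups G = {N. N \<lhd> G}"

definition burnside_u :: "('a, 'm) monoid_scheme \<Rightarrow> 'a set \<Rightarrow> 'a burnside" where
  "burnside_u G N =
     \<one>\<^bsub>burnside_ring G\<^esub> \<ominus>\<^bsub>burnside_ring G\<^esub> burnside_class G (coset_gset G N)"

end

theory Submission
  imports Defs "HOL-Algebra.Multiplicative_Group"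
begin

text \<open>Everything is read off from the marks. By Burnside's theorem they separate the elements of
  \<open>\<Omega>(G)\<close> (\<open>marks_determine_gset\<close>, \<open>burnside_eqI\<close>), so \<open>\<Omega>(G)\<close> is a subring of a product of copies
  of \<open>\<int>\<close>. Units have marks \<open>\<plusminus>1\<close>, and an element all of whose marks are \<open>\<plusminus>1\<close> is its own inverse.

  Let \<open>M\<close> be the subgroup of index two of the cyclic group \<open>C\<close>. A unit of \<open>\<Omega>(C)\<close> has only two
  independent marks, one shared by the subgroups of \<open>M\<close> and one shared by all other subgroups
  (\<open>unit_marks_normal_subgroups\<close>). The reason is a divisibility: in a \<open>C\<close>-set, the number of points
  with stabilizer exactly \<open>D\<close> is a multiple of \<open>|C : D|\<close>, whereas a discrepancy between marks
  \<open>\<plusminus>1\<close> is at most \<open>2\<close>. So the units are \<open>\<plusminus>1\<close> and \<open>\<plusminus>u\<^sub>M\<close>.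

  Under \<open>\<alpha>\<close>, the mark of the image at \<open>K\<close> is the mark at the subgroup of \<open>C\<close> of order \<open>|K|\<close>. That
  subgroup lies in \<open>M\<close> iff \<open>|G : K|\<close> is even. Hence \<open>\<alpha>(u\<^sub>M)\<close> has mark \<open>-1\<close> at the subgroups of even
  index and \<open>1\<close> at those of odd index. The product of all \<open>u\<^sub>N\<close> with \<open>|G : N| = 2\<close> has mark
  \<open>(-1)\<^sup>m\<close> at \<open>K\<close>, where \<open>m\<close> counts the \<open>N\<close> containing \<open>K\<close>; for a 2-seminilpotent group this is the same
  function of \<open>K\<close> (\<open>mark_index_two_product\<close>). Therefore \<open>\<alpha>(u\<^sub>M)\<close> is that product. It lies in the
  span of the \<open>[G/N]\<close>, \<open>N\<close> normal, because this span is closed under multiplication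
  (\<open>span_mult\<close>).\<close>

section \<open>Finite \<open>G\<close>-sets\<close>

locale finite_group = group +
  assumes fin [simp]: "finite (carrier G)"

context group
begin

lemma finite_gset_iff:
  "finite_gset G X \<longleftrightarrow>
     finite (fst X) \<and>
     (\<forall>g\<in>carrier G. snd X g \<in> extensional (fst X) \<and> (\<forall>x\<in>fst X. snd X g x \<in> fst X)) \<and>
     (\<forall>x\<in>fst X. snd X \<one> x = x) \<and>
     (\<forall>g\<in>carrier G. \<forall>h\<in>carrier G. \<forall>x\<in>fst X. snd X (g \<otimes> h) x = snd X g (snd X h x))"
  (is "?L \<longleftrightarrow> ?R")
proof
  assume ?L
  then interpret group_action G "fst X" "snd X"
    by (simp add: finite_gset_def)
  have "snd X g \<in> extensional (fst X)" if "g \<in> carrier G" for g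
    using bij_prop0[OF that] by (simp add: Bij_def)
  moreover have "snd X \<one> x = x" if "x \<in> fst X" for x
    using that by (simp flip: id_eq_one)
  moreover have "finite (fst X)"
    using \<open>?L\<close> by (simp add: finite_gset_def)
  ultimately show ?R
    by (intro conjI ballI) (simp_all add: composition_rule element_image[OF _ _ refl])
next
  assume R: ?R
  note mult = R[THEN conjunct2, THEN conjunct2, THEN conjunct2, rule_format]
    and one = R[THEN conjunct2, THEN conjunct2, THEN conjunct1, rule_format]
    and ext = R[THEN conjunct2, THEN conjunct1, rule_format, THEN conjunct1]
    and closed = R[THEN conjunct2, THEN conjunct1, rule_format, THEN conjunct2, rule_format]
  have "bij_betw (snd X g) (fst X) (fst X)" if g: "g \<in> carrier G" for g
  proof (rule bij_betw_byWitness[where f' = "snd X (inv g)"])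
    show "\<forall>x\<in>fst X. snd X (inv g) (snd X g x) = x"
      using g by (simp add: one flip: mult)
    show "\<forall>x\<in>fst X. snd X g (snd X (inv g) x) = x"
      using g by (simp add: one flip: mult)
  qed (use closed g in auto)
  then have Bij: "snd X g \<in> Bij (fst X)" if "g \<in> carrier G" for g
    using ext that by (simp add: Bij_def)
  have "snd X (g \<otimes> h) = compose (fst X) (snd X g) (snd X h)"
    if g: "g \<in> carrier G" "h \<in> carrier G" for g h
  proof (rule extensionalityI[where A = "fst X"])
    show "snd X (g \<otimes> h) \<in> extensional (fst X)"
      using ext g by simp
  qed (simp_all add: compose_eq mult g)
  with Bij have "snd X \<in> hom G (BijGroup (fst X))"
    by (simp add: hom_def BijGroup_def)
  then show ?L
    using R[THEN conjunct1] group_BijGroup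
    by (simp add: finite_gset_def group_action_def group_hom_def group_hom_axioms_def is_group)
qed

lemma
  assumes "finite_gset G X"
  shows gset_finite: "finite (fst X)"
    and gset_closed: "\<And>g x. g \<in> carrier G \<Longrightarrow> x \<in> fst X \<Longrightarrow> snd X g x \<in> fst X"
    and gset_one: "\<And>x. x \<in> fst X \<Longrightarrow> snd X \<one> x = x"
    and gset_mult: "\<And>g h x. g \<in> carrier G \<Longrightarrow> h \<in> carrier G \<Longrightarrow> x \<in> fst X \<Longrightarrow>
                      snd X (g \<otimes> h) x = snd X g (snd X h x)"
  using assms by (auto simp: finite_gset_iff)

lemma
  assumes "finite_gset G X" "g \<in> carrier G" "x \<in> fst X"
  shows gset_inv: "snd X (inv g) (snd X g x) = x"
    and gset_inv': "snd X g (snd X (inv g) x) = x"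
  using assms gset_one[OF assms(1,3)] by (simp_all flip: gset_mult)

lemma gset_action: "finite_gset G X \<Longrightarrow> group_action G (fst X) (snd X)"
  by (simp add: finite_gset_def)

lemma stabilizer_is_subgroup:
  "finite_gset G X \<Longrightarrow> x \<in> fst X \<Longrightarrow> subgroup (stabilizer G (snd X) x) G"
  by (metis gset_action group_action.stabilizer_subgroup)

lemma mem_fixed_points_iff:
  "K \<subseteq> carrier G \<Longrightarrow>
     x \<in> fixed_points K X \<longleftrightarrow> x \<in> fst X \<and> K \<subseteq> stabilizer G (snd X) x"
  by (auto simp: fixed_points_def stabilizer_def)

lemma finite_fixed_points [simp]: "finite_gset G X \<Longrightarrow> finite (fixed_points K X)"
  by (simp add: fixed_points_def gset_finite)

end

lemma gset_iso_refl: "gset_iso G X X"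
  unfolding gset_iso_def by (intro exI[of _ id]) auto

lemma (in group) gset_iso_sym:
  assumes "finite_gset G X" "gset_iso G X Y"
  shows "gset_iso G Y X"
proof -
  obtain f where f: "bij_betw f (fst X) (fst Y)"
    and eq: "\<And>g x. g \<in> carrier G \<Longrightarrow> x \<in> fst X \<Longrightarrow> f (snd X g x) = snd Y g (f x)"
    using assms(2) by (auto simp: gset_iso_def)
  let ?h = "inv_into (fst X) f"
  have "?h (snd Y g y) = snd X g (?h y)" if "g \<in> carrier G" "y \<in> fst Y" for g y
  proof -
    from f that have "?h y \<in> fst X" "f (?h y) = y"
      by (auto simp: bij_betw_def inv_into_into f_inv_into_f)
    then show ?thesis
      using eq[OF that(1), of "?h y"] f gset_closed[OF assms(1) that(1)]
      by (metis bij_betw_inv_into_left)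
  qed
  then show ?thesis
    unfolding gset_iso_def using bij_betw_inv_into[OF f] by blast
qed

lemma gset_iso_trans:
  assumes "gset_iso G X Y" "gset_iso G Y Z"
  shows "gset_iso G X Z"
proof -
  obtain f h where "bij_betw f (fst X) (fst Y)" "bij_betw h (fst Y) (fst Z)"
    "\<forall>g\<in>carrier G. \<forall>x\<in>fst X. f (snd X g x) = snd Y g (f x)"
    "\<forall>g\<in>carrier G. \<forall>x\<in>fst Y. h (snd Y g x) = snd Z g (h x)"
    using assms by (auto simp: gset_iso_def)
  then show ?thesis
    unfolding gset_iso_def
    by (intro exI[of _ "h \<circ> f"]) (auto simp: bij_betw_trans dest: bij_betwE)
qed

lemma (in group) card_fixed_points_iso:
  assumes "gset_iso G X Y" "finite_gset G X" "K \<subseteq> carrier G"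
  shows "card (fixed_points K X) = card (fixed_points K Y)"
proof -
  obtain f where f: "bij_betw f (fst X) (fst Y)"
    and eq: "\<forall>g\<in>carrier G. \<forall>x\<in>fst X. f (snd X g x) = snd Y g (f x)"
    using assms by (auto simp: gset_iso_def)
  have "snd X k x = x \<longleftrightarrow> snd Y k (f x) = f x" if "k \<in> K" "x \<in> fst X" for k x
  proof -
    have "k \<in> carrier G"
      using that assms by auto
    with that eq f gset_closed[OF assms(2)] show ?thesis
      by (metis bij_betw_inv_into_left)
  qed
  then have "bij_betw f (fixed_points K X) (fixed_points K Y)"
    unfolding fixed_points_def by (intro bij_betw_Collect f) auto
  then show ?thesis
    by (rule bij_betw_same_card)
qed

text \<open>Sums and products of \<open>G\<close>-sets live on other types; transport of structure brings them back to
  the natural numbers.\<close>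

lemma (in group) transport_gset:
  assumes X: "finite_gset G X" and f: "bij_betw f (fst X) B"
  defines "Y \<equiv> (B, \<lambda>g. \<lambda>y\<in>B. f (snd X g (inv_into (fst X) f y)))"
  shows "finite_gset G Y" "gset_iso G X Y"
proof -
  have B: "inv_into (fst X) f y \<in> fst X" "f (inv_into (fst X) f y) = y" if "y \<in> B" for y
    using that f by (auto simp: bij_betw_def inv_into_into f_inv_into_f)
  have f': "f x \<in> B" "inv_into (fst X) f (f x) = x" if "x \<in> fst X" for x
    using that f by (auto simp: bij_betw_def)
  show "finite_gset G Y"
    unfolding finite_gset_iff Y_def
    using bij_betw_finite[OF f] gset_finite[OF X]
    by (auto simp: B f' gset_closed[OF X] gset_one[OF X] gset_mult[OF X])
  show "gset_iso G X Y"
    unfolding gset_iso_def Y_def using f by (intro exI[of _ f]) (auto simp: f' gset_closed[OF X])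
qed

lemma (in group) ex_nat_gset:
  assumes "finite_gset G X"
  obtains Y :: "('a, nat) gset" where "finite_gset G Y" "gset_iso G X Y"
proof -
  obtain f :: "_ \<Rightarrow> nat" where "bij_betw f (fst X) {0..<card (fst X)}"
    using ex_bij_betw_finite_nat[OF gset_finite[OF assms]] by blast
  from that[OF transport_gset[OF assms this]] show thesis .
qed

lemma (in group) finite_gset_sum:
  "finite_gset G X \<Longrightarrow> finite_gset G Y \<Longrightarrow> finite_gset G (gset_sum X Y)"
  unfolding finite_gset_iff gset_sum_def by (auto simp: finite_Plus)

lemma (in group) finite_gset_prod:
  "finite_gset G X \<Longrightarrow> finite_gset G Y \<Longrightarrow> finite_gset G (gset_prod X Y)"
  unfolding finite_gset_iff gset_prod_def by auto

lemma (in group) finite_gset_empty: "finite_gset G empty_gset"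
  unfolding finite_gset_iff empty_gset_def by auto

lemma (in finite_group) finite_gset_coset:
  assumes "subgroup H G"
  shows "finite_gset G (coset_gset G H)"
proof -
  have H: "H \<subseteq> carrier G"
    using assms subgroup.subset by blast
  have "finite (lcosets H)"
    using finite_subset[OF lcosets_subset_PowG[OF assms]] by simp
  moreover have "g <# A \<in> lcosets H" if "g \<in> carrier G" "A \<in> lcosets H" for g A
    using that H by (auto simp: LCOSETS_def lcos_m_assoc)
  moreover have "A \<subseteq> carrier G" if "A \<in> lcosets H" for A
    using that lcosets_subset_PowG[OF assms] by auto
  ultimately show ?thesis
    unfolding finite_gset_iff coset_gset_def by (simp add: lcos_mult_one lcos_m_assoc)
qed

lemma (in group) card_fixed_points_sum:
  assumes "K \<subseteq> carrier G" "finite_gset G X" "finite_gset G Y"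
  shows "card (fixed_points K (gset_sum X Y)) =
           card (fixed_points K X) + card (fixed_points K Y)"
proof -
  have "fixed_points K (gset_sum X Y) = fixed_points K X <+> fixed_points K Y"
    by (auto simp: fixed_points_def gset_sum_def)
  then show ?thesis
    using assms by (simp add: card_Plus)
qed

lemma (in group) card_fixed_points_prod:
  assumes "K \<subseteq> carrier G" "finite_gset G X" "finite_gset G Y"
  shows "card (fixed_points K (gset_prod X Y)) =
           card (fixed_points K X) * card (fixed_points K Y)"
proof -
  have "fixed_points K (gset_prod X Y) = fixed_points K X \<times> fixed_points K Y"
    by (auto simp: fixed_points_def gset_prod_def)
  then show ?thesis
    by (simp add: card_cartesian_product)
qed

lemma fixed_points_empty [simp]: "fixed_points K empty_gset = {}"
  by (simp add: fixed_points_def empty_gset_def)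

section \<open>Orbits and stabilizers\<close>

lemma (in finite_group) subgroup_index_mult_card:
  "subgroup H G \<Longrightarrow> subgroup_index G H * card H = order G"
  using lagrange_finite by (simp add: subgroup_index_def)

lemma (in finite_group) finite_subgroup [simp]: "subgroup H G \<Longrightarrow> finite H"
  by (meson fin finite_subset subgroup.subset)

lemma (in finite_group) card_subgroup_pos: "subgroup H G \<Longrightarrow> card H > 0"
  using subgroup.one_closed by (metis card_gt_0_iff empty_iff finite_subgroup)

lemma (in finite_group) index_pos: "subgroup H G \<Longrightarrow> subgroup_index G H > 0"
  using subgroup_index_mult_card by (metis fin gr0I mult_is_0 order_gt_0_iff_finite)

lemma (in group) stabilizer_translate:
  assumes X: "finite_gset G X" and "L \<lhd> G"
    and x: "x \<in> fst X" "stabilizer G (snd X) x = L" and g: "g \<in> carrier G"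
  shows "stabilizer G (snd X) (snd X g x) = L"
proof -
  interpret group_action G "fst X" "snd X"
    using X by (rule gset_action)
  have conj: "inv h \<otimes> k \<otimes> h \<in> L \<longleftrightarrow> k \<in> L" if "h \<in> carrier G" "k \<in> carrier G" for h k
  proof
    assume "inv h \<otimes> k \<otimes> h \<in> L"
    then have "h \<otimes> (inv h \<otimes> k \<otimes> h) \<otimes> inv h \<in> L"
      using that normal_invE(2)[OF assms(2)] by blast
    moreover have "h \<otimes> (inv h \<otimes> k \<otimes> h) \<otimes> inv h = k"
      using that by (simp add: m_assoc[symmetric]) (simp add: m_assoc)
    ultimately show "k \<in> L" by simp
  qed (use that normal_invE(2)[OF assms(2), of "inv h"] in auto)
  have "snd X k (snd X g x) = snd X g x \<longleftrightarrow> snd X (inv g \<otimes> k \<otimes> g) x = x"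
    if k: "k \<in> carrier G" for k
  proof -
    have "snd X (inv g \<otimes> k \<otimes> g) x = snd X (inv g) (snd X k (snd X g x))"
      using g k x by (simp add: gset_mult[OF X] gset_closed[OF X])
    then show ?thesis
      using gset_inv[OF X g x(1)] gset_inv'[OF X g] gset_closed[OF X] g k x by metis
  qed
  then show ?thesis
    using x conj g by (auto simp: stabilizer_def)
qed

text \<open>For normal \<open>L\<close>, all stabilizers along the orbit of a point with stabilizer \<open>L\<close> are equal to
  \<open>L\<close>, so the points counted here form whole orbits, each of size \<open>|G : L|\<close>.\<close>

lemma (in finite_group) index_dvd_card_stabilizer_eq:
  assumes X: "finite_gset G X" and L: "L \<lhd> G"
  shows "subgroup_index G L dvd card {x \<in> fst X. stabilizer G (snd X) x = L}"
    (is "_ dvd card ?S")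
proof -
  interpret group_action G "fst X" "snd X"
    using X by (rule gset_action)
  have sub: "subgroup L G"
    using L normal_imp_subgroup by blast
  let ?O = "orbit G (snd X) ` ?S"
  have U: "\<Union> ?O = ?S"
  proof
    show "?S \<subseteq> \<Union> ?O"
      using orbit_refl by auto
    show "\<Union> ?O \<subseteq> ?S"
      using stabilizer_translate[OF X L] gset_closed[OF X] by (auto simp: orbit_def)
  qed
  have "card (orbit G (snd X) x) = subgroup_index G L" if "x \<in> ?S" for x
  proof -
    have "card (orbit G (snd X) x) * card L = subgroup_index G L * card L"
      using orbit_stabilizer_theorem[of x] that subgroup_index_mult_card[OF sub] by simp
    then show ?thesis
      using card_subgroup_pos[OF sub] by simp
  qed
  moreover have "c1 \<inter> c2 = {}" if "c1 \<in> ?O" "c2 \<in> ?O" "c1 \<noteq> c2" for c1 c2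
    using that disjoint_union[of c1 c2] by (auto simp: orbits_def)
  ultimately have "subgroup_index G L dvd card (\<Union> ?O)"
    using gset_finite[OF X] by (intro dvd_partition) (auto simp: U)
  then show ?thesis
    by (simp only: U)
qed

lemma (in finite_group) card_fixed_points_strata:
  assumes X: "finite_gset G X" and K: "K \<subseteq> carrier G"
  shows "card (fixed_points K X) =
    (\<Sum>L | subgroup L G \<and> K \<subseteq> L. card {x \<in> fst X. stabilizer G (snd X) x = L})"
proof -
  have "finite {L. subgroup L G \<and> K \<subseteq> L}"
    by (rule finite_subset[of _ "Pow (carrier G)"]) (auto dest: subgroup.subset)
  moreover have "fixed_points K X =
      (\<Union>L\<in>{L. subgroup L G \<and> K \<subseteq> L}. {x \<in> fst X. stabilizer G (snd X) x = L})"
    using stabilizer_is_subgroup[OF X] by (auto simp: mem_fixed_points_iff[OF K])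
  moreover have "card (\<Union>L\<in>{L. subgroup L G \<and> K \<subseteq> L}. {x \<in> fst X. stabilizer G (snd X) x = L}) =
      (\<Sum>L | subgroup L G \<and> K \<subseteq> L. card {x \<in> fst X. stabilizer G (snd X) x = L})"
    using calculation(1) gset_finite[OF X] by (intro card_UN_disjoint) auto
  ultimately show ?thesis
    by simp
qed

section \<open>Burnside's theorem: marks determine a finite \<open>G\<close>-set\<close>

context group
begin

lemma translate_eq_iff:
  assumes X: "finite_gset G X" and "x \<in> fst X" "g \<in> carrier G" "h \<in> carrier G"
  shows "snd X g x = snd X h x \<longleftrightarrow> inv h \<otimes> g \<in> stabilizer G (snd X) x"
proof -
  have "snd X (inv h \<otimes> g) x = snd X (inv h) (snd X g x)"
    using assms by (simp add: gset_mult[OF X])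
  moreover have "snd X h (snd X (inv h) (snd X g x)) = snd X g x"
    using assms by (simp add: gset_inv'[OF X] gset_closed[OF X])
  moreover have "snd X (inv h) (snd X h x) = x"
    using assms by (simp add: gset_inv[OF X])
  moreover have "inv h \<otimes> g \<in> carrier G"
    using assms by simp
  ultimately show ?thesis
    unfolding stabilizer_def by (metis (mono_tags, lifting) mem_Collect_eq)
qed

text \<open>Both orbits are copies of \<open>G/H\<close>, where \<open>H\<close> is the common stabilizer.\<close>

lemma orbits_iso:
  assumes X: "finite_gset G X" and Y: "finite_gset G Y" and x: "x \<in> fst X" and y: "y \<in> fst Y"
    and stab: "stabilizer G (snd X) x = stabilizer G (snd Y) y"
  obtains f where "bij_betw f (orbit G (snd X) x) (orbit G (snd Y) y)"
    and "\<And>g z. g \<in> carrier G \<Longrightarrow> z \<in> orbit G (snd X) x \<Longrightarrow> f (snd X g z) = snd Y g (f z)"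
proof -
  have same: "snd X g x = snd X h x \<longleftrightarrow> snd Y g y = snd Y h y"
    if "g \<in> carrier G" "h \<in> carrier G" for g h
    using that x y by (simp add: translate_eq_iff[OF X] translate_eq_iff[OF Y] stab)
  define f where "f z = snd Y (SOME g. g \<in> carrier G \<and> snd X g x = z) y" for z
  have f: "f (snd X g x) = snd Y g y" if g: "g \<in> carrier G" for g
  proof -
    let ?h = "SOME h. h \<in> carrier G \<and> snd X h x = snd X g x"
    have h: "?h \<in> carrier G \<and> snd X ?h x = snd X g x"
      by (rule someI[of _ g]) (use g in simp)
    then have "snd Y ?h y = snd Y g y"
      using same[of ?h g] g by simp
    then show ?thesis by (simp add: f_def)
  qed
  have "bij_betw f (orbit G (snd X) x) (orbit G (snd Y) y)"
  proof (rule bij_betw_imageI)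
    show "inj_on f (orbit G (snd X) x)"
      using same by (auto simp: inj_on_def orbit_def f)
    show "f ` orbit G (snd X) x = orbit G (snd Y) y"
      by (force simp: orbit_def f image_iff)
  qed
  moreover have "f (snd X g z) = snd Y g (f z)"
    if g: "g \<in> carrier G" and z: "z \<in> orbit G (snd X) x" for g z
  proof -
    obtain h where h: "h \<in> carrier G" "z = snd X h x"
      using z by (auto simp: orbit_def)
    have "f (snd X (g \<otimes> h) x) = snd Y (g \<otimes> h) y"
      using g h by (intro f) simp
    then show ?thesis
      using g h x y by (simp add: f gset_mult[OF X] gset_mult[OF Y])
  qed
  ultimately show thesis
    by (rule that)
qed

lemma orbit_closed:
  assumes "finite_gset G X" "x \<in> fst X" "g \<in> carrier G" "z \<in> orbit G (snd X) x"
  shows "snd X g z \<in> orbit G (snd X) x"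
proof -
  obtain h where "h \<in> carrier G" "z = snd X h x"
    using assms(4) by (auto simp: orbit_def)
  then show ?thesis
    using assms gset_mult[OF assms(1), of g h x] unfolding orbit_def
    by (auto intro!: exI[of _ "g \<otimes> h"])
qed

lemma orbit_translate_mem_iff:
  assumes X: "finite_gset G X" "x \<in> fst X" "g \<in> carrier G" "z \<in> fst X"
  shows "snd X g z \<in> orbit G (snd X) x \<longleftrightarrow> z \<in> orbit G (snd X) x"
  using orbit_closed[OF X(1,2), of "inv g" "snd X g z"] orbit_closed[OF X(1-3)]
    gset_inv[OF X(1,3,4)] X(3) by auto

end

context finite_group
begin

lemma card_Int_split:
  assumes "finite S" "T \<subseteq> S"
  shows "card (S \<inter> F) = card (T \<inter> F) + card ((S - T) \<inter> F)"
proof -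
  have "finite T"
    using assms finite_subset by blast
  moreover have "S \<inter> F = (T \<inter> F) \<union> ((S - T) \<inter> F)" "(T \<inter> F) \<inter> ((S - T) \<inter> F) = {}"
    using assms by auto
  ultimately show ?thesis
    using assms by (metis card_Un_disjoint finite_Diff finite_Int)
qed

text \<open>A maximal stabilizer \<open>H\<close> of a point in \<open>A\<close> is also a maximal stabilizer in \<open>B\<close>, because a
  subgroup fixes a point of \<open>A\<close> iff it fixes a point of \<open>B\<close>. Removing an orbit with stabilizer \<open>H\<close>
  from both sides keeps the marks equal.\<close>

lemma marks_determine_invariant_subset:
  assumes X: "finite_gset G X" and Y: "finite_gset G Y"
    and "A \<subseteq> fst X" "\<And>g x. g \<in> carrier G \<Longrightarrow> x \<in> A \<Longrightarrow> snd X g x \<in> A"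
    and "B \<subseteq> fst Y" "\<And>g y. g \<in> carrier G \<Longrightarrow> y \<in> B \<Longrightarrow> snd Y g y \<in> B"
    and "\<And>K. subgroup K G \<Longrightarrow> card (A \<inter> fixed_points K X) = card (B \<inter> fixed_points K Y)"
  shows "\<exists>f. bij_betw f A B \<and> (\<forall>g\<in>carrier G. \<forall>x\<in>A. f (snd X g x) = snd Y g (f x))"
  using assms(3-)
proof (induction "card A" arbitrary: A B rule: less_induct)
  case less
  note marks = less.prems(5)
  have finA: "finite A" and finB: "finite B"
    using less.prems(1,3) gset_finite[OF X] gset_finite[OF Y] finite_subset by blast+
  show ?case
  proof (cases "A = {}")
    case True
    have "B \<inter> fixed_points {\<one>} Y = B"
      using less.prems(3) gset_one[OF Y] by (auto simp: fixed_points_def)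
    then have "B = {}"
      using marks[OF triv_subgroup] True finB by simp
    with True show ?thesis
      by (auto simp: bij_betw_def)
  next
    case False
    obtain x where x: "x \<in> A"
      and max: "\<And>z. z \<in> A \<Longrightarrow> card (stabilizer G (snd X) z) \<le> card (stabilizer G (snd X) x)"
      using obtains_MAX[OF finA False, of "\<lambda>z. card (stabilizer G (snd X) z)"] finA
      by (metis (no_types, lifting) Max_ge finite_imageI imageI)
    define H where "H = stabilizer G (snd X) x"
    have xX: "x \<in> fst X"
      using x less.prems(1) by blast
    have H: "subgroup H G"
      unfolding H_def by (rule stabilizer_is_subgroup[OF X xX])
    have "x \<in> A \<inter> fixed_points H X"
      using x xX subgroup.subset[OF H] by (simp add: mem_fixed_points_iff H_def)
    then have "B \<inter> fixed_points H Y \<noteq> {}"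
      using marks[OF H] finA by (metis Int_iff card_eq_0_iff card.empty empty_iff finite_Int)
    then obtain y where y: "y \<in> B" "y \<in> fst Y" "H \<subseteq> stabilizer G (snd Y) y"
      using subgroup.subset[OF H] by (auto simp: mem_fixed_points_iff)
    let ?H' = "stabilizer G (snd Y) y"
    have H': "subgroup ?H' G"
      by (rule stabilizer_is_subgroup[OF Y y(2)])
    have "y \<in> B \<inter> fixed_points ?H' Y"
      using y subgroup.subset[OF H'] by (simp add: mem_fixed_points_iff)
    then have "A \<inter> fixed_points ?H' X \<noteq> {}"
      using marks[OF H'] finB by (metis Int_iff card_eq_0_iff card.empty empty_iff finite_Int)
    then obtain z where z: "z \<in> A" "z \<in> fst X" "?H' \<subseteq> stabilizer G (snd X) z"
      using subgroup.subset[OF H'] by (auto simp: mem_fixed_points_iff)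
    have "card ?H' \<le> card H"
      using card_mono[OF _ z(3)] max[OF z(1)] finite_subgroup[OF stabilizer_is_subgroup[OF X z(2)]]
      by (simp add: H_def)
    then have stab: "H = ?H'"
      using y(3) finite_subgroup[OF H'] by (intro card_seteq) auto
    let ?P = "orbit G (snd X) x" and ?Q = "orbit G (snd Y) y"
    obtain f where f: "bij_betw f ?P ?Q"
      and f_eq: "\<And>g z. g \<in> carrier G \<Longrightarrow> z \<in> ?P \<Longrightarrow> f (snd X g z) = snd Y g (f z)"
      using orbits_iso[OF X Y xX y(2)] stab H_def by blast
    have PA: "?P \<subseteq> A" and QB: "?Q \<subseteq> B"
      using x y(1) less.prems(2,4) by (auto simp: orbit_def)
    have "card (?P \<inter> fixed_points K X) = card (?Q \<inter> fixed_points K Y)" if K: "subgroup K G" for K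
    proof -
      have "(\<forall>k\<in>K. snd Y k (f z) = f z) \<longleftrightarrow> (\<forall>k\<in>K. snd X k z = z)" if "z \<in> ?P" for z
      proof (rule ball_cong[OF refl])
        fix k assume "k \<in> K"
        then have k: "k \<in> carrier G"
          using subgroup.subset[OF K] by blast
        show "snd Y k (f z) = f z \<longleftrightarrow> snd X k z = z"
          using f_eq[OF k that] orbit_closed[OF X xX k that] f that
          by (metis bij_betw_inv_into_left)
      qed
      then have "bij_betw f {z \<in> ?P. \<forall>k\<in>K. snd X k z = z} {z \<in> ?Q. \<forall>k\<in>K. snd Y k z = z}"
        by (intro bij_betw_Collect f) auto
      moreover have "?P \<inter> fixed_points K X = {z \<in> ?P. \<forall>k\<in>K. snd X k z = z}"
        "?Q \<inter> fixed_points K Y = {z \<in> ?Q. \<forall>k\<in>K. snd Y k z = z}"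
        using PA QB less.prems(1,3) by (auto simp: fixed_points_def)
      ultimately show ?thesis
        by (simp add: bij_betw_same_card)
    qed
    note marksP = this
    have marks': "card ((A - ?P) \<inter> fixed_points K X) = card ((B - ?Q) \<inter> fixed_points K Y)"
      if K: "subgroup K G" for K
      using marksP[OF K] card_Int_split[OF finA PA] card_Int_split[OF finB QB] marks[OF K]
      by (metis add_left_cancel)
    have "card (A - ?P) < card A"
      using x group_action.orbit_refl[OF gset_action[OF X] xX] finA
      by (intro psubset_card_mono) auto
    moreover have "snd X g z \<in> A - ?P" if "g \<in> carrier G" "z \<in> A - ?P" for g z
      using that less.prems(1,2) orbit_translate_mem_iff[OF X xX] by blast
    moreover have "snd Y g z \<in> B - ?Q" if "g \<in> carrier G" "z \<in> B - ?Q" for g z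
      using that less.prems(3,4) orbit_translate_mem_iff[OF Y y(2)] by blast
    moreover have "A - ?P \<subseteq> fst X" "B - ?Q \<subseteq> fst Y"
      using less.prems(1,3) by auto
    ultimately have "\<exists>h. bij_betw h (A - ?P) (B - ?Q) \<and>
        (\<forall>g\<in>carrier G. \<forall>z\<in>A - ?P. h (snd X g z) = snd Y g (h z))"
      using marks' by (intro less.hyps)
    then obtain h where h: "bij_betw h (A - ?P) (B - ?Q)"
      and h_eq: "\<forall>g\<in>carrier G. \<forall>z\<in>A - ?P. h (snd X g z) = snd Y g (h z)"
      by (elim exE conjE)
    let ?f = "\<lambda>z. if z \<in> ?P then f z else h z"
    have "bij_betw ?f (?P \<union> (A - ?P)) (?Q \<union> (B - ?Q))"
    proof (rule bij_betw_combine)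
      show "bij_betw ?f ?P ?Q"
        using f by (rule bij_betw_cong[THEN iffD1, rotated]) simp
      show "bij_betw ?f (A - ?P) (B - ?Q)"
        using h by (rule bij_betw_cong[THEN iffD1, rotated]) simp
    qed simp
    moreover have "?P \<union> (A - ?P) = A" "?Q \<union> (B - ?Q) = B"
      using PA QB by auto
    moreover have "?f (snd X g z) = snd Y g (?f z)" if "g \<in> carrier G" "z \<in> A" for g z
    proof -
      have "z \<in> fst X"
        using that less.prems(1) by blast
      then show ?thesis
        using f_eq h_eq that orbit_translate_mem_iff[OF X xX that(1)] by simp
    qed
    ultimately show ?thesis
      by (intro exI[of _ ?f]) simp
  qed
qed

theorem marks_determine_gset:
  assumes X: "finite_gset G X" and Y: "finite_gset G Y"
    and "\<And>K. subgroup K G \<Longrightarrow> card (fixed_points K X) = card (fixed_points K Y)"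
  shows "gset_iso G X Y"
proof -
  have "fst X \<inter> fixed_points K X = fixed_points K X" "fst Y \<inter> fixed_points K Y = fixed_points K Y" for K
    by (auto simp: fixed_points_def)
  then show ?thesis
    unfolding gset_iso_def
    using assms by (intro marks_determine_invariant_subset[OF X Y]) (simp_all add: gset_closed)
qed

end

section \<open>The Burnside ring embeds into its ghost ring\<close>

text \<open>All members of an isomorphism class have the same number of \<open>K\<close>-fixed points, so the choice is
  immaterial.\<close>

definition class_mark :: "'a set \<Rightarrow> 'a gset_class \<Rightarrow> nat" where
  "class_mark K a = card (fixed_points K (SOME X. X \<in> a))"

lemma UN_UN_constant:
  assumes "x \<in> A" "y \<in> B" and "\<And>x' y'. x' \<in> A \<Longrightarrow> y' \<in> B \<Longrightarrow> F x' y' = F x y"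
  shows "(\<Union>x'\<in>A. \<Union>y'\<in>B. F x' y') = F x y"
  using assms by blast

context finite_group
begin

abbreviation (input) "\<S> \<equiv> gset_semiring G"

lemma iso_class_eqI:
  assumes X: "finite_gset G X" and Y: "finite_gset G Y"
    and "\<And>K. subgroup K G \<Longrightarrow> card (fixed_points K X) = card (fixed_points K Y)"
  shows "iso_class G X = iso_class G Y"
proof -
  have XY: "gset_iso G X Y"
    by (rule marks_determine_gset[OF assms])
  have YX: "gset_iso G Y X"
    by (rule gset_iso_sym[OF X XY])
  show ?thesis
    using gset_iso_trans[OF XY] gset_iso_trans[OF YX] by (auto simp: iso_class_def)
qed

lemma class_mark_iso_class:
  assumes X: "finite_gset G X" and K: "subgroup K G"
  shows "class_mark K (iso_class G X) = card (fixed_points K X)"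
proof -
  obtain Y where "Y \<in> iso_class G X"
    using ex_nat_gset[OF X] unfolding iso_class_def by blast
  then have "(SOME Y. Y \<in> iso_class G X) \<in> iso_class G X"
    by (rule someI[of "\<lambda>Y. Y \<in> iso_class G X"])
  then have "gset_iso G X (SOME Y. Y \<in> iso_class G X)"
    unfolding iso_class_def by blast
  then show ?thesis
    unfolding class_mark_def by (rule card_fixed_points_iso[OF _ X subgroup.subset[OF K], symmetric])
qed

lemma iso_class_closed:
  assumes X: "finite_gset G X"
  shows "iso_class G X \<in> carrier \<S>"
proof -
  obtain Y :: "('a, nat) gset" where Y: "finite_gset G Y" "gset_iso G X Y"
    using ex_nat_gset[OF X] by blast
  have "iso_class G X = iso_class G Y"
    by (intro iso_class_eqI X Y card_fixed_points_iso subgroup.subset)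
  then show ?thesis
    using Y(1) unfolding gset_semiring_def partial_object.simps by blast
qed

lemma
  assumes "a \<in> carrier \<S>" "X \<in> a"
  shows finite_gset_member: "finite_gset G X"
    and class_eq_iso_class_member: "a = iso_class G X"
proof -
  obtain Z :: "('a, nat) gset" where Z: "finite_gset G Z" "a = iso_class G Z"
    using assms(1) by (auto simp: gset_semiring_def)
  with assms(2) have X: "finite_gset G X" "gset_iso G Z X"
    by (auto simp: iso_class_def)
  show "finite_gset G X"
    by fact
  show "a = iso_class G X"
    unfolding Z(2) by (intro iso_class_eqI card_fixed_points_iso Z X subgroup.subset)
qed

lemma class_mark_member:
  "a \<in> carrier \<S> \<Longrightarrow> X \<in> a \<Longrightarrow> subgroup K G \<Longrightarrow> class_mark K a = card (fixed_points K X)"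
  using class_mark_iso_class finite_gset_member class_eq_iso_class_member by metis

lemma class_nonempty:
  assumes "a \<in> carrier \<S>"
  shows "a \<noteq> {}"
proof -
  obtain Z :: "('a, nat) gset" where "finite_gset G Z" "a = iso_class G Z"
    using assms by (auto simp: gset_semiring_def)
  then have "Z \<in> a"
    by (simp add: iso_class_def gset_iso_refl)
  then show ?thesis by auto
qed

lemma class_eqI:
  assumes a: "a \<in> carrier \<S>" and b: "b \<in> carrier \<S>"
    and "\<And>K. subgroup K G \<Longrightarrow> class_mark K a = class_mark K b"
  shows "a = b"
proof -
  obtain X Y where "X \<in> a" "Y \<in> b"
    using class_nonempty a b by blast
  then show ?thesis
    using assms iso_class_eqI[of X Y]
    by (metis class_eq_iso_class_member class_mark_member finite_gset_member)
qed

lemma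
  assumes a: "a \<in> carrier \<S>" and b: "b \<in> carrier \<S>"
  shows semiring_add_closed: "a \<oplus>\<^bsub>\<S>\<^esub> b \<in> carrier \<S>"
    and class_mark_add: "\<And>K. subgroup K G \<Longrightarrow>
      class_mark K (a \<oplus>\<^bsub>\<S>\<^esub> b) = class_mark K a + class_mark K b"
    and semiring_mult_closed: "a \<otimes>\<^bsub>\<S>\<^esub> b \<in> carrier \<S>"
    and class_mark_mult: "\<And>K. subgroup K G \<Longrightarrow>
      class_mark K (a \<otimes>\<^bsub>\<S>\<^esub> b) = class_mark K a * class_mark K b"
proof -
  obtain X Y where X: "X \<in> a" and Y: "Y \<in> b"
    using class_nonempty a b by blast
  note finX = finite_gset_member[OF a X] and finY = finite_gset_member[OF b Y]
  have fixed: "card (fixed_points K X') = class_mark K a" "card (fixed_points K Y') = class_mark K b"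
    if "X' \<in> a" "Y' \<in> b" "subgroup K G" for X' Y' K
    using class_mark_member a b that by auto
  have "iso_class G (gset_sum X' Y') = iso_class G (gset_sum X Y)"
    if "X' \<in> a" "Y' \<in> b" for X' Y'
    using that X Y finite_gset_member[OF a] finite_gset_member[OF b]
    by (intro iso_class_eqI) (simp_all add: finite_gset_sum card_fixed_points_sum subgroup.subset fixed)
  then have sum: "a \<oplus>\<^bsub>\<S>\<^esub> b = iso_class G (gset_sum X Y)"
    unfolding gset_semiring_def ring.simps monoid.simps by (rule UN_UN_constant[OF X Y])
  show "a \<oplus>\<^bsub>\<S>\<^esub> b \<in> carrier \<S>"
    by (simp add: sum iso_class_closed finite_gset_sum finX finY)
  show "class_mark K (a \<oplus>\<^bsub>\<S>\<^esub> b) = class_mark K a + class_mark K b" if "subgroup K G" for K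
    by (simp add: sum class_mark_iso_class finite_gset_sum card_fixed_points_sum finX finY that
        subgroup.subset fixed[OF X Y])
  have "iso_class G (gset_prod X' Y') = iso_class G (gset_prod X Y)"
    if "X' \<in> a" "Y' \<in> b" for X' Y'
    using that X Y finite_gset_member[OF a] finite_gset_member[OF b]
    by (intro iso_class_eqI) (simp_all add: finite_gset_prod card_fixed_points_prod subgroup.subset fixed)
  then have prod: "a \<otimes>\<^bsub>\<S>\<^esub> b = iso_class G (gset_prod X Y)"
    unfolding gset_semiring_def ring.simps monoid.simps by (rule UN_UN_constant[OF X Y])
  show "a \<otimes>\<^bsub>\<S>\<^esub> b \<in> carrier \<S>"
    by (simp add: prod iso_class_closed finite_gset_prod finX finY)
  show "class_mark K (a \<otimes>\<^bsub>\<S>\<^esub> b) = class_mark K a * class_mark K b" if "subgroup K G" for K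
    by (simp add: prod class_mark_iso_class finite_gset_prod card_fixed_points_prod finX finY that
        subgroup.subset fixed[OF X Y])
qed

lemma semiring_zero_closed: "\<zero>\<^bsub>\<S>\<^esub> \<in> carrier \<S>"
  and class_mark_zero: "subgroup K G \<Longrightarrow> class_mark K \<zero>\<^bsub>\<S>\<^esub> = 0"
proof -
  have "finite_gset G (empty_gset :: ('a, nat) gset)"
    by (rule finite_gset_empty)
  moreover have "\<zero>\<^bsub>\<S>\<^esub> = iso_class G (empty_gset :: ('a, nat) gset)"
    by (simp add: gset_semiring_def)
  ultimately show "\<zero>\<^bsub>\<S>\<^esub> \<in> carrier \<S>" "subgroup K G \<Longrightarrow> class_mark K \<zero>\<^bsub>\<S>\<^esub> = 0"
    using iso_class_closed class_mark_iso_class by (metis, metis card.empty fixed_points_empty)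
qed

text \<open>A coset \<open>gN\<close> is fixed by \<open>K\<close> iff \<open>g\<inverse>Kg \<subseteq> N\<close>, which for normal \<open>N\<close> does not depend on \<open>g\<close>.\<close>

lemma card_fixed_points_coset_normal:
  assumes N: "N \<lhd> G" and K: "subgroup K G"
  shows "card (fixed_points K (coset_gset G N)) = (if K \<subseteq> N then subgroup_index G N else 0)"
proof -
  interpret N: normal N G by fact
  have sub: "subgroup N G"
    by (rule N.subgroup_axioms)
  have "k <# (g <# N) = g <# N \<longleftrightarrow> k \<in> N" if k: "k \<in> carrier G" and g: "g \<in> carrier G" for k g
  proof -
    have "k <# (g <# N) = N #> (k \<otimes> g)" "g <# N = N #> g"
      using k g N.subset by (simp_all add: lcos_m_assoc N.coset_eq)
    moreover have "N #> (k \<otimes> g) = (N #> k) #> g"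
      using k g N.subset by (simp add: coset_mult_assoc)
    moreover have "(N #> k) #> g = N #> g \<longleftrightarrow> N #> k = N"
    proof
      assume "N #> k #> g = N #> g"
      then have "N #> k #> g #> inv g = N #> g #> inv g"
        by simp
      then show "N #> k = N"
        using k g N.subset by (simp add: coset_mult_assoc m_assoc)
    qed simp
    moreover have "N #> k = N \<longleftrightarrow> k \<in> N"
      using k sub coset_join1 coset_join2 N.subset by blast
    ultimately show ?thesis by simp
  qed
  then have "k <# A = A \<longleftrightarrow> k \<in> N" if "k \<in> K" "A \<in> lcosets N" for k A
    using that subgroup.subset[OF K] by (auto simp: LCOSETS_def)
  then have "fixed_points K (coset_gset G N) = (if K \<subseteq> N then lcosets N else {})"
    by (auto simp: fixed_points_def coset_gset_def)
  moreover have "card (lcosets N) = subgroup_index G N"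
    using l_lagrange[OF fin sub] subgroup_index_mult_card[OF sub] card_subgroup_pos[OF sub]
    by (metis mult_right_cancel less_numeral_extra(3))
  ultimately show ?thesis by simp
qed

lemma carrier_normal: "carrier G \<lhd> G"
  by (simp add: normal_inv_iff subgroup_self)

lemma subgroup_index_carrier: "subgroup_index G (carrier G) = 1"
  using subgroup_index_mult_card[OF subgroup_self] carrier_not_empty by (simp add: order_def)

lemma semiring_one_closed: "\<one>\<^bsub>\<S>\<^esub> \<in> carrier \<S>"
  using iso_class_closed[OF finite_gset_coset[OF subgroup_self]] by (simp add: gset_semiring_def)

lemma class_mark_one: "subgroup K G \<Longrightarrow> class_mark K \<one>\<^bsub>\<S>\<^esub> = 1"
  using class_mark_iso_class[OF finite_gset_coset[OF subgroup_self]]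
  by (simp add: gset_semiring_def card_fixed_points_coset_normal carrier_normal
      subgroup_index_carrier subgroup.subset)

lemmas semiring_closed =
  semiring_add_closed semiring_mult_closed semiring_zero_closed semiring_one_closed
lemmas class_mark_simps = class_mark_add class_mark_mult class_mark_zero class_mark_one

text \<open>Marks are natural numbers, additive, and separate the classes, so the extra summand in the
  Grothendieck relation cancels.\<close>

lemma groth_rel_iff:
  "((a, b), (c, d)) \<in> groth_rel \<S> \<longleftrightarrow>
     a \<in> carrier \<S> \<and> b \<in> carrier \<S> \<and> c \<in> carrier \<S> \<and> d \<in> carrier \<S> \<and>
     (\<forall>K. subgroup K G \<longrightarrow>
        int (class_mark K a) - int (class_mark K b) = int (class_mark K c) - int (class_mark K d))"
proof -
  let ?C = "a \<in> carrier \<S> \<and> b \<in> carrier \<S> \<and> c \<in> carrier \<S> \<and> d \<in> carrier \<S>"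
  let ?M = "\<lambda>K. int (class_mark K a) - int (class_mark K b) =
    int (class_mark K c) - int (class_mark K d)"
  have "(\<exists>e\<in>carrier \<S>. a \<oplus>\<^bsub>\<S>\<^esub> d \<oplus>\<^bsub>\<S>\<^esub> e = c \<oplus>\<^bsub>\<S>\<^esub> b \<oplus>\<^bsub>\<S>\<^esub> e) \<longleftrightarrow> (\<forall>K. subgroup K G \<longrightarrow> ?M K)" if ?C
  proof
    assume "\<exists>e\<in>carrier \<S>. a \<oplus>\<^bsub>\<S>\<^esub> d \<oplus>\<^bsub>\<S>\<^esub> e = c \<oplus>\<^bsub>\<S>\<^esub> b \<oplus>\<^bsub>\<S>\<^esub> e"
    then obtain e where e: "e \<in> carrier \<S>" "a \<oplus>\<^bsub>\<S>\<^esub> d \<oplus>\<^bsub>\<S>\<^esub> e = c \<oplus>\<^bsub>\<S>\<^esub> b \<oplus>\<^bsub>\<S>\<^esub> e"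
      by blast
    show "\<forall>K. subgroup K G \<longrightarrow> ?M K"
    proof (intro allI impI)
      fix K assume "subgroup K G"
      moreover have "class_mark K (a \<oplus>\<^bsub>\<S>\<^esub> d \<oplus>\<^bsub>\<S>\<^esub> e) = class_mark K (c \<oplus>\<^bsub>\<S>\<^esub> b \<oplus>\<^bsub>\<S>\<^esub> e)"
        by (simp only: e(2))
      ultimately show "?M K"
        using \<open>?C\<close> e(1) by (simp add: class_mark_simps semiring_closed)
    qed
  next
    assume M: "\<forall>K. subgroup K G \<longrightarrow> ?M K"
    have "a \<oplus>\<^bsub>\<S>\<^esub> d \<oplus>\<^bsub>\<S>\<^esub> \<zero>\<^bsub>\<S>\<^esub> = c \<oplus>\<^bsub>\<S>\<^esub> b \<oplus>\<^bsub>\<S>\<^esub> \<zero>\<^bsub>\<S>\<^esub>"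
    proof (rule class_eqI)
      fix K assume K: "subgroup K G"
      then have "?M K"
        using M by blast
      then show "class_mark K (a \<oplus>\<^bsub>\<S>\<^esub> d \<oplus>\<^bsub>\<S>\<^esub> \<zero>\<^bsub>\<S>\<^esub>) = class_mark K (c \<oplus>\<^bsub>\<S>\<^esub> b \<oplus>\<^bsub>\<S>\<^esub> \<zero>\<^bsub>\<S>\<^esub>)"
        using K \<open>?C\<close> by (simp add: class_mark_simps semiring_closed)
    qed (use \<open>?C\<close> in \<open>simp_all add: semiring_closed\<close>)
    then show "\<exists>e\<in>carrier \<S>. a \<oplus>\<^bsub>\<S>\<^esub> d \<oplus>\<^bsub>\<S>\<^esub> e = c \<oplus>\<^bsub>\<S>\<^esub> b \<oplus>\<^bsub>\<S>\<^esub> e"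
      using semiring_zero_closed by blast
  qed
  then show ?thesis
    unfolding groth_rel_def by auto
qed

lemma mem_groth_class_iff:
  assumes "a \<in> carrier \<S>" "b \<in> carrier \<S>"
  shows "(c, d) \<in> groth_class \<S> a b \<longleftrightarrow> c \<in> carrier \<S> \<and> d \<in> carrier \<S> \<and>
     (\<forall>K. subgroup K G \<longrightarrow>
        int (class_mark K c) - int (class_mark K d) = int (class_mark K a) - int (class_mark K b))"
  using assms by (auto simp: groth_class_def groth_rel_iff)

lemma groth_class_eqI:
  assumes abcd: "a \<in> carrier \<S>" "b \<in> carrier \<S>" "c \<in> carrier \<S>" "d \<in> carrier \<S>"
    and "\<And>K. subgroup K G \<Longrightarrow>
        int (class_mark K a) - int (class_mark K b) = int (class_mark K c) - int (class_mark K d)"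
  shows "groth_class \<S> a b = groth_class \<S> c d"
proof -
  have "p \<in> groth_class \<S> a b \<longleftrightarrow> p \<in> groth_class \<S> c d" for p
    using assms(5) by (cases p) (simp add: mem_groth_class_iff abcd)
  then show ?thesis
    by blast
qed

abbreviation (input) "\<Omega> \<equiv> burnside_ring G"

lemma burnside_carrier_iff:
  "x \<in> carrier \<Omega> \<longleftrightarrow> (\<exists>a\<in>carrier \<S>. \<exists>b\<in>carrier \<S>. x = groth_class \<S> a b)"
  by (auto simp: burnside_ring_def grothendieck_ring_def quotient_def groth_class_def)

lemma groth_class_closed: "a \<in> carrier \<S> \<Longrightarrow> b \<in> carrier \<S> \<Longrightarrow> groth_class \<S> a b \<in> carrier \<Omega>"
  by (auto simp: burnside_carrier_iff)

lemma mark_groth_class: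
  assumes ab: "a \<in> carrier \<S>" "b \<in> carrier \<S>" and K: "subgroup K G"
  shows "mark G K (groth_class \<S> a b) = int (class_mark K a) - int (class_mark K b)"
proof -
  let ?v = "int (class_mark K a) - int (class_mark K b)"
  let ?T = "{int (card (fixed_points K X)) - int (card (fixed_points K Y)) | X Y.
    \<exists>A B. (A, B) \<in> groth_class \<S> a b \<and> X \<in> A \<and> Y \<in> B}"
  have val: "int (card (fixed_points K X)) - int (card (fixed_points K Y)) = ?v"
    if "(A, B) \<in> groth_class \<S> a b" "X \<in> A" "Y \<in> B" for A B X Y
    using that K by (simp add: mem_groth_class_iff[OF ab]) (metis class_mark_member)
  obtain X Y where XY: "X \<in> a" "Y \<in> b"
    using class_nonempty ab by blast
  have mem: "(a, b) \<in> groth_class \<S> a b"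
    using ab by (simp add: mem_groth_class_iff)
  have "?v \<in> ?T"
    by (rule CollectI, rule exI[of _ X], rule exI[of _ Y], rule conjI[OF val[OF mem XY, symmetric]],
        rule exI[of _ a], rule exI[of _ b]) (simp add: mem XY)
  moreover have "t = ?v" if t: "t \<in> ?T" for t
    using t by (elim CollectE exE conjE) (simp add: val)
  ultimately have "?T = {?v}"
    by blast
  then show ?thesis
    by (simp add: mark_def)
qed

theorem burnside_eqI:
  assumes "x \<in> carrier \<Omega>" "y \<in> carrier \<Omega>"
    and marks: "\<And>K. subgroup K G \<Longrightarrow> mark G K x = mark G K y"
  shows "x = y"
proof -
  obtain a b c d where abcd: "a \<in> carrier \<S>" "b \<in> carrier \<S>" "c \<in> carrier \<S>" "d \<in> carrier \<S>"
    and eq: "x = groth_class \<S> a b" "y = groth_class \<S> c d"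
    using assms(1,2) by (auto simp: burnside_carrier_iff)
  have "int (class_mark K a) - int (class_mark K b) = int (class_mark K c) - int (class_mark K d)"
    if "subgroup K G" for K
    using marks[OF that] that abcd by (simp add: eq mark_groth_class)
  then show ?thesis
    unfolding eq by (intro groth_class_eqI abcd)
qed

lemma
  assumes ab: "a \<in> carrier \<S>" "b \<in> carrier \<S>" and cd: "c \<in> carrier \<S>" "d \<in> carrier \<S>"
  shows burnside_add: "groth_class \<S> a b \<oplus>\<^bsub>\<Omega>\<^esub> groth_class \<S> c d = groth_class \<S> (a \<oplus>\<^bsub>\<S>\<^esub> c) (b \<oplus>\<^bsub>\<S>\<^esub> d)"
    and burnside_mult: "groth_class \<S> a b \<otimes>\<^bsub>\<Omega>\<^esub> groth_class \<S> c d =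
      groth_class \<S> (a \<otimes>\<^bsub>\<S>\<^esub> c \<oplus>\<^bsub>\<S>\<^esub> b \<otimes>\<^bsub>\<S>\<^esub> d) (a \<otimes>\<^bsub>\<S>\<^esub> d \<oplus>\<^bsub>\<S>\<^esub> b \<otimes>\<^bsub>\<S>\<^esub> c)"
proof -
  have mem: "(a, b) \<in> groth_class \<S> a b" "(c, d) \<in> groth_class \<S> c d"
    using ab cd by (simp_all add: mem_groth_class_iff)
  have "groth_class \<S> (a' \<oplus>\<^bsub>\<S>\<^esub> c') (b' \<oplus>\<^bsub>\<S>\<^esub> d') = groth_class \<S> (a \<oplus>\<^bsub>\<S>\<^esub> c) (b \<oplus>\<^bsub>\<S>\<^esub> d)"
    if p: "(a', b') \<in> groth_class \<S> a b" and q: "(c', d') \<in> groth_class \<S> c d" for a' b' c' d'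
  proof -
    note p = p[unfolded mem_groth_class_iff[OF ab]] and q = q[unfolded mem_groth_class_iff[OF cd]]
    show ?thesis
      by (rule groth_class_eqI)
        (use ab cd p q in \<open>force simp: semiring_closed class_mark_simps\<close>)+
  qed
  then show "groth_class \<S> a b \<oplus>\<^bsub>\<Omega>\<^esub> groth_class \<S> c d = groth_class \<S> (a \<oplus>\<^bsub>\<S>\<^esub> c) (b \<oplus>\<^bsub>\<S>\<^esub> d)"
    using UN_UN_constant[OF mem, of "\<lambda>(a', b') (c', d'). groth_class \<S> (a' \<oplus>\<^bsub>\<S>\<^esub> c') (b' \<oplus>\<^bsub>\<S>\<^esub> d')"]
    by (auto simp: burnside_ring_def grothendieck_ring_def case_prod_unfold)
  have "groth_class \<S> (a' \<otimes>\<^bsub>\<S>\<^esub> c' \<oplus>\<^bsub>\<S>\<^esub> b' \<otimes>\<^bsub>\<S>\<^esub> d') (a' \<otimes>\<^bsub>\<S>\<^esub> d' \<oplus>\<^bsub>\<S>\<^esub> b' \<otimes>\<^bsub>\<S>\<^esub> c') =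
      groth_class \<S> (a \<otimes>\<^bsub>\<S>\<^esub> c \<oplus>\<^bsub>\<S>\<^esub> b \<otimes>\<^bsub>\<S>\<^esub> d) (a \<otimes>\<^bsub>\<S>\<^esub> d \<oplus>\<^bsub>\<S>\<^esub> b \<otimes>\<^bsub>\<S>\<^esub> c)"
    if p: "(a', b') \<in> groth_class \<S> a b" and q: "(c', d') \<in> groth_class \<S> c d" for a' b' c' d'
  proof -
    note p = p[unfolded mem_groth_class_iff[OF ab]] and q = q[unfolded mem_groth_class_iff[OF cd]]
    show ?thesis
    proof (rule groth_class_eqI)
      fix K assume K: "subgroup K G"
      define m where "m = (\<lambda>e. int (class_mark K e))"
      have expand: "int (class_mark K (r \<otimes>\<^bsub>\<S>\<^esub> t \<oplus>\<^bsub>\<S>\<^esub> s \<otimes>\<^bsub>\<S>\<^esub> u)) -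
          int (class_mark K (r \<otimes>\<^bsub>\<S>\<^esub> u \<oplus>\<^bsub>\<S>\<^esub> s \<otimes>\<^bsub>\<S>\<^esub> t)) = (m r - m s) * (m t - m u)"
        if "r \<in> carrier \<S>" "s \<in> carrier \<S>" "t \<in> carrier \<S>" "u \<in> carrier \<S>" for r s t u
        using that K by (simp add: semiring_closed class_mark_simps m_def algebra_simps)
      have "m a' - m b' = m a - m b" "m c' - m d' = m c - m d"
        using p q K by (simp_all add: m_def)
      then show "int (class_mark K (a' \<otimes>\<^bsub>\<S>\<^esub> c' \<oplus>\<^bsub>\<S>\<^esub> b' \<otimes>\<^bsub>\<S>\<^esub> d')) -
          int (class_mark K (a' \<otimes>\<^bsub>\<S>\<^esub> d' \<oplus>\<^bsub>\<S>\<^esub> b' \<otimes>\<^bsub>\<S>\<^esub> c')) =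
          int (class_mark K (a \<otimes>\<^bsub>\<S>\<^esub> c \<oplus>\<^bsub>\<S>\<^esub> b \<otimes>\<^bsub>\<S>\<^esub> d)) -
          int (class_mark K (a \<otimes>\<^bsub>\<S>\<^esub> d \<oplus>\<^bsub>\<S>\<^esub> b \<otimes>\<^bsub>\<S>\<^esub> c))"
        using ab cd p q by (simp add: expand)
    qed (use ab cd p q in \<open>simp_all add: semiring_closed\<close>)
  qed
  then show "groth_class \<S> a b \<otimes>\<^bsub>\<Omega>\<^esub> groth_class \<S> c d =
      groth_class \<S> (a \<otimes>\<^bsub>\<S>\<^esub> c \<oplus>\<^bsub>\<S>\<^esub> b \<otimes>\<^bsub>\<S>\<^esub> d) (a \<otimes>\<^bsub>\<S>\<^esub> d \<oplus>\<^bsub>\<S>\<^esub> b \<otimes>\<^bsub>\<S>\<^esub> c)"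
    using UN_UN_constant[OF mem, of "\<lambda>(a', b') (c', d').
        groth_class \<S> (a' \<otimes>\<^bsub>\<S>\<^esub> c' \<oplus>\<^bsub>\<S>\<^esub> b' \<otimes>\<^bsub>\<S>\<^esub> d') (a' \<otimes>\<^bsub>\<S>\<^esub> d' \<oplus>\<^bsub>\<S>\<^esub> b' \<otimes>\<^bsub>\<S>\<^esub> c')"]
    by (auto simp: burnside_ring_def grothendieck_ring_def case_prod_unfold)
qed

lemma
  assumes "x \<in> carrier \<Omega>" "y \<in> carrier \<Omega>"
  shows burnside_add_closed: "x \<oplus>\<^bsub>\<Omega>\<^esub> y \<in> carrier \<Omega>"
    and burnside_mult_closed: "x \<otimes>\<^bsub>\<Omega>\<^esub> y \<in> carrier \<Omega>"
    and mark_add: "\<And>K. subgroup K G \<Longrightarrow> mark G K (x \<oplus>\<^bsub>\<Omega>\<^esub> y) = mark G K x + mark G K y"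
    and mark_mult: "\<And>K. subgroup K G \<Longrightarrow> mark G K (x \<otimes>\<^bsub>\<Omega>\<^esub> y) = mark G K x * mark G K y"
proof -
  obtain a b c d where abcd: "a \<in> carrier \<S>" "b \<in> carrier \<S>" "c \<in> carrier \<S>" "d \<in> carrier \<S>"
    "x = groth_class \<S> a b" "y = groth_class \<S> c d"
    using assms by (auto simp: burnside_carrier_iff)
  then show "x \<oplus>\<^bsub>\<Omega>\<^esub> y \<in> carrier \<Omega>" "x \<otimes>\<^bsub>\<Omega>\<^esub> y \<in> carrier \<Omega>"
    by (simp_all add: burnside_add burnside_mult groth_class_closed semiring_closed)
  fix K assume "subgroup K G"
  with abcd show "mark G K (x \<oplus>\<^bsub>\<Omega>\<^esub> y) = mark G K x + mark G K y"
    "mark G K (x \<otimes>\<^bsub>\<Omega>\<^esub> y) = mark G K x * mark G K y"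
    by (simp_all add: burnside_add burnside_mult mark_groth_class semiring_closed class_mark_simps
        algebra_simps)
qed

lemma
  shows burnside_zero_closed: "\<zero>\<^bsub>\<Omega>\<^esub> \<in> carrier \<Omega>"
    and mark_zero: "\<And>K. subgroup K G \<Longrightarrow> mark G K \<zero>\<^bsub>\<Omega>\<^esub> = 0"
    and burnside_one_closed: "\<one>\<^bsub>\<Omega>\<^esub> \<in> carrier \<Omega>"
    and mark_one: "\<And>K. subgroup K G \<Longrightarrow> mark G K \<one>\<^bsub>\<Omega>\<^esub> = 1"
proof -
  have "\<zero>\<^bsub>\<Omega>\<^esub> = groth_class \<S> \<zero>\<^bsub>\<S>\<^esub> \<zero>\<^bsub>\<S>\<^esub>" "\<one>\<^bsub>\<Omega>\<^esub> = groth_class \<S> \<one>\<^bsub>\<S>\<^esub> \<zero>\<^bsub>\<S>\<^esub>"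
    by (simp_all add: burnside_ring_def grothendieck_ring_def)
  then show "\<zero>\<^bsub>\<Omega>\<^esub> \<in> carrier \<Omega>" "\<one>\<^bsub>\<Omega>\<^esub> \<in> carrier \<Omega>"
    "\<And>K. subgroup K G \<Longrightarrow> mark G K \<zero>\<^bsub>\<Omega>\<^esub> = 0" "\<And>K. subgroup K G \<Longrightarrow> mark G K \<one>\<^bsub>\<Omega>\<^esub> = 1"
    by (simp_all add: groth_class_closed mark_groth_class semiring_closed class_mark_simps)
qed

text \<open>The ring axioms hold because they hold for the integer-valued marks, which separate the
  elements of the carrier.\<close>

theorem burnside_cring: "cring \<Omega>"
proof (rule cringI)
  note closed = burnside_add_closed burnside_mult_closed burnside_zero_closed burnside_one_closed
  note marks = mark_add mark_mult mark_zero mark_one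
  show "abelian_group \<Omega>"
  proof (rule abelian_groupI)
    fix x assume x: "x \<in> carrier \<Omega>"
    then obtain a b where "a \<in> carrier \<S>" "b \<in> carrier \<S>" "x = groth_class \<S> a b"
      by (auto simp: burnside_carrier_iff)
    moreover from this have "groth_class \<S> b a \<in> carrier \<Omega>"
      by (simp add: groth_class_closed)
    moreover from calculation have "groth_class \<S> b a \<oplus>\<^bsub>\<Omega>\<^esub> x = \<zero>\<^bsub>\<Omega>\<^esub>"
      by (intro burnside_eqI) (simp_all add: closed marks mark_groth_class groth_class_closed)
    ultimately show "\<exists>y\<in>carrier \<Omega>. y \<oplus>\<^bsub>\<Omega>\<^esub> x = \<zero>\<^bsub>\<Omega>\<^esub>"
      by blast
  qed (simp_all add: closed, (rule burnside_eqI; simp add: closed marks)+)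
  show "comm_monoid \<Omega>"
    by (rule comm_monoidI; (simp add: closed)?) (rule burnside_eqI; simp add: closed marks)+
  show "(x \<oplus>\<^bsub>\<Omega>\<^esub> y) \<otimes>\<^bsub>\<Omega>\<^esub> z = x \<otimes>\<^bsub>\<Omega>\<^esub> z \<oplus>\<^bsub>\<Omega>\<^esub> y \<otimes>\<^bsub>\<Omega>\<^esub> z"
    if "x \<in> carrier \<Omega>" "y \<in> carrier \<Omega>" "z \<in> carrier \<Omega>" for x y z
    by (rule burnside_eqI) (use that in \<open>simp_all add: closed marks distrib_right\<close>)
qed

lemma
  assumes "finite_gset G X"
  shows burnside_class_closed: "burnside_class G X \<in> carrier \<Omega>"
    and mark_burnside_class: "\<And>K. subgroup K G \<Longrightarrow>
      mark G K (burnside_class G X) = int (card (fixed_points K X))"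
  using assms unfolding burnside_class_def
  by (simp_all add: groth_class_closed mark_groth_class iso_class_closed class_mark_iso_class
      semiring_zero_closed class_mark_zero)

end

sublocale finite_group \<subseteq> burnside: cring "burnside_ring G"
  by (rule burnside_cring)

context finite_group
begin

lemma mark_uminus:
  assumes x: "x \<in> carrier \<Omega>" and K: "subgroup K G"
  shows "mark G K (\<ominus>\<^bsub>\<Omega>\<^esub> x) = - mark G K x"
  using mark_add[OF x burnside.a_inv_closed[OF x] K] mark_zero[OF K] x
  by (simp add: burnside.r_neg)

lemma mark_minus:
  "x \<in> carrier \<Omega> \<Longrightarrow> y \<in> carrier \<Omega> \<Longrightarrow> subgroup K G \<Longrightarrow>
     mark G K (x \<ominus>\<^bsub>\<Omega>\<^esub> y) = mark G K x - mark G K y"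
  by (simp add: a_minus_def mark_add mark_uminus)

lemma mark_finprod:
  assumes "finite A" "f \<in> A \<rightarrow> carrier \<Omega>" "subgroup K G"
  shows "mark G K (\<Otimes>\<^bsub>\<Omega>\<^esub>i\<in>A. f i) = (\<Prod>i\<in>A. mark G K (f i))"
  using assms
proof (induction A rule: finite_induct)
  case (insert i A)
  then show ?case
    by (simp add: burnside.finprod_insert Pi_iff mark_mult burnside.finprod_closed)
qed (simp add: mark_one)

lemma mark_unit:
  assumes "x \<in> Units \<Omega>" "subgroup K G"
  shows "mark G K x = 1 \<or> mark G K x = -1"
proof -
  obtain y where "y \<in> carrier \<Omega>" "x \<in> carrier \<Omega>" "x \<otimes>\<^bsub>\<Omega>\<^esub> y = \<one>\<^bsub>\<Omega>\<^esub>"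
    using assms(1) unfolding Units_def by blast
  then have "mark G K x * mark G K y = 1"
    using mark_mult mark_one assms(2) by metis
  then show ?thesis
    by (simp add: zmult_eq_1_iff) blast
qed

end

section \<open>Subgroups of small index and subgroups of cyclic groups\<close>

context finite_group
begin

lemma card_subgroup_dvd:
  assumes "subgroup K G" "subgroup N G" "K \<subseteq> N"
  shows "card K dvd card N"
proof -
  interpret N: group "G\<lparr>carrier := N\<rparr>"
    using assms(2) by (rule subgroup_imp_group)
  have "card (rcosets\<^bsub>G\<lparr>carrier := N\<rparr>\<^esub> K) * card K = card N"
    using N.lagrange[OF subgroup_incl[OF assms]] by (simp add: order_def)
  then show ?thesis
    by (metis dvd_triv_right)
qed

lemma subgroup_eq_carrier_iff: "subgroup H G \<Longrightarrow> H = carrier G \<longleftrightarrow> subgroup_index G H = 1"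
  using subgroup_index_mult_card[of H] subgroup_index_carrier
    card_subset_eq[OF fin subgroup.subset, of H]
  by (auto simp: order_def)

lemma index_two_imp_normal:
  assumes N: "subgroup N G" and index: "subgroup_index G N = 2"
  shows "N \<lhd> G"
proof (rule normal_invI[OF N])
  fix x h assume x: "x \<in> carrier G" and h: "h \<in> N"
  have hG: "h \<in> carrier G"
    using h subgroup.subset[OF N] by blast
  show "x \<otimes> h \<otimes> inv x \<in> N"
  proof (cases "x \<in> N")
    case True
    then show ?thesis
      using h N by (simp add: subgroup.m_closed subgroup.m_inv_closed)
  next
    case False
    \<comment> \<open>Both \<open>x\<close> and \<open>xh\<close> lie outside \<open>N\<close>, hence in the only other right coset.\<close>
    have xh: "x \<otimes> h \<notin> N"
    proof
      assume "x \<otimes> h \<in> N"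
      then have "x \<otimes> h \<otimes> inv h \<in> N"
        using N h by (simp add: subgroup.m_closed subgroup.m_inv_closed)
      with False x hG show False
        by (simp add: m_assoc)
    qed
    have out: "N #> y \<in> rcosets N - {N}" if "y \<in> carrier G" "y \<notin> N" for y
      using that rcos_self[OF that(1) N] by (auto simp: RCOSETS_def)
    have "N \<in> rcosets N"
      using subgroup.subgroup_in_rcosets[OF N is_group] .
    then have "card (rcosets N - {N}) = 1"
      using index by (simp add: subgroup_index_def)
    then have "N #> (x \<otimes> h) = N #> x"
      using out[OF _ xh] out[OF x False] x hG by (metis card_1_singletonE m_closed singletonD)
    then have "x \<otimes> h \<in> N #> x"
      using rcos_self[OF _ N, of "x \<otimes> h"] x hG by simp
    then show ?thesis
      using subgroup.rcos_module_imp[OF N is_group x] by blast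
  qed
qed

text \<open>Let \<open>|G| = kq\<close> and let \<open>c\<close> generate \<open>G\<close>. Then \<open>(c\<^sup>i)\<^sup>k = 1\<close> iff \<open>q\<close> divides \<open>i\<close>, so \<open>g = c\<^sup>q\<close> generates the
  \<open>k\<close>-torsion. It follows that the \<open>k\<close>-torsion is the only subgroup of order \<open>k\<close>.\<close>

lemma cyclic_torsion_subgroup:
  assumes cyc: "cyclic_group G" and k: "k dvd order G"
  obtains g where "g \<in> carrier G" "ord g = k" "{x \<in> carrier G. x [^] k = \<one>} = generate G {g}"
proof -
  obtain c where c: "c \<in> carrier G" and c_gen: "subgroup_generated G {c} = G"
    using cyc by (auto simp: cyclic_group_def)
  have gen_c: "generate G {c} = carrier G"
    using c c_gen carrier_subgroup_generated[of G "{c}"] by simp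
  have ord: "ord c = order G"
    using cyclic_order_is_ord[OF c] c_gen by simp
  have n: "order G > 0"
    by (simp add: order_gt_0_iff_finite)
  obtain q where q: "order G = k * q"
    using k by blast
  have pos: "k > 0" "q > 0"
    using n q by auto
  let ?g = "c [^] q"
  have g: "?g \<in> carrier G" "ord ?g = k"
    using c q pos by (simp_all add: ord_pow ord)
  have "{x \<in> carrier G. x [^] k = \<one>} = generate G {?g}"
  proof (intro equalityI subsetI)
    fix x assume x: "x \<in> {x \<in> carrier G. x [^] k = \<one>}"
    then have "x \<in> generate G {c}"
      by (simp add: gen_c)
    then obtain i :: int where i: "x = c [^] i"
      using generate_pow[OF c] by blast
    have "c [^] (i * int k) = (c [^] i) [^] int k"
      using c by (simp add: int_pow_pow)
    also have "\<dots> = \<one>"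
      using x by (simp add: i int_pow_int)
    finally have "c [^] (i * int k) = \<one>" .
    then have "int (k * q) dvd i * int k"
      using int_pow_eq_id[OF c] ord q by simp
    then have "int q dvd i"
      using pos by (simp add: mult.commute)
    then obtain j where "i = int q * j"
      by blast
    then have "x = ?g [^] j"
      using c by (simp add: i int_pow_pow flip: int_pow_int)
    then show "x \<in> generate G {?g}"
      using generate_pow[OF g(1)] by blast
  next
    fix x assume "x \<in> generate G {?g}"
    then obtain j :: int where j: "x = ?g [^] j"
      using generate_pow[OF g(1)] by blast
    have "x [^] k = \<one>"
    proof -
      have "x [^] k = (?g [^] (int k * j))"
        using g(1) by (simp add: j int_pow_pow mult.commute flip: int_pow_int)
      also have "\<dots> = \<one>"
        using int_pow_eq_id[OF g(1)] g(2) by simp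
      finally show ?thesis .
    qed
    then show "x \<in> {x \<in> carrier G. x [^] k = \<one>}"
      using j g(1) by simp
  qed
  then show thesis
    using that g by blast
qed

lemma
  assumes "cyclic_group G" "k dvd order G"
  shows torsion_is_subgroup: "subgroup {x \<in> carrier G. x [^] k = \<one>} G"
    and card_torsion: "card {x \<in> carrier G. x [^] k = \<one>} = k"
proof -
  obtain g where g: "g \<in> carrier G" "ord g = k" "{x \<in> carrier G. x [^] k = \<one>} = generate G {g}"
    using cyclic_torsion_subgroup[OF assms] .
  show "subgroup {x \<in> carrier G. x [^] k = \<one>} G"
    unfolding g(3) using g(1) by (intro generate_is_subgroup) simp
  show "card {x \<in> carrier G. x [^] k = \<one>} = k"
    unfolding g(3) using g by (simp add: generate_pow_card[symmetric])
qed

lemma cyclic_subgroup_eq_torsion: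
  assumes cyc: "cyclic_group G" and H: "subgroup H G"
  shows "H = {x \<in> carrier G. x [^] card H = \<one>}"
proof (rule card_subset_eq)
  interpret H: group "G\<lparr>carrier := H\<rparr>"
    using H by (rule subgroup_imp_group)
  show "H \<subseteq> {x \<in> carrier G. x [^] card H = \<one>}"
    using H.pow_order_eq_1 subgroup.subset[OF H] by (auto simp: order_def simp flip: nat_pow_consistent)
  show "card H = card {x \<in> carrier G. x [^] card H = \<one>}"
    using card_torsion[OF cyc] subgroup_index_mult_card[OF H] by (metis dvd_triv_right)
qed simp

lemma subgroup_of_order_cyclic:
  assumes "cyclic_group G" "k dvd order G"
  shows "subgroup_of_order G k = {x \<in> carrier G. x [^] k = \<one>}"
  unfolding subgroup_of_order_def
  using torsion_is_subgroup[OF assms] card_torsion[OF assms] cyclic_subgroup_eq_torsion[OF assms(1)]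
  by (intro the_equality) auto

lemma torsion_mono_iff:
  assumes "cyclic_group G" "k dvd order G"
  shows "{x \<in> carrier G. x [^] k = \<one>} \<subseteq> {x \<in> carrier G. x [^] l = \<one>} \<longleftrightarrow> k dvd l"
proof
  assume sub: "{x \<in> carrier G. x [^] k = \<one>} \<subseteq> {x \<in> carrier G. x [^] l = \<one>}"
  obtain g where g: "g \<in> carrier G" "ord g = k"
    using cyclic_torsion_subgroup[OF assms] .
  then have "g [^] l = \<one>"
    using sub pow_eq_id[OF g(1), of k] by auto
  then show "k dvd l"
    using pow_eq_id[OF g(1), of l] g(2) by simp
next
  assume kl: "k dvd l"
  show "{x \<in> carrier G. x [^] k = \<one>} \<subseteq> {x \<in> carrier G. x [^] l = \<one>}"
  proof
    fix x assume x: "x \<in> {x \<in> carrier G. x [^] k = \<one>}"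
    then have "ord x dvd k"
      using pow_eq_id[of x k] by simp
    then have "ord x dvd l"
      using kl by (rule dvd_trans)
    then show "x \<in> {x \<in> carrier G. x [^] l = \<one>}"
      using x pow_eq_id[of x l] by simp
  qed
qed

section \<open>Marks of units when all subgroups are normal\<close>

text \<open>For \<open>x = [X] - [Y]\<close>, the term \<open>e L\<close> is the difference of the numbers of points with stabilizer
  exactly \<open>L\<close>.\<close>

lemma mark_strata:
  assumes x: "x \<in> carrier \<Omega>"
  obtains e where "\<And>K. subgroup K G \<Longrightarrow> mark G K x = (\<Sum>L | subgroup L G \<and> K \<subseteq> L. e L)"
    and "\<And>L. L \<lhd> G \<Longrightarrow> int (subgroup_index G L) dvd e L"
proof -
  obtain a b where ab: "a \<in> carrier \<S>" "b \<in> carrier \<S>" "x = groth_class \<S> a b"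
    using x by (auto simp: burnside_carrier_iff)
  obtain X Y where XY: "X \<in> a" "Y \<in> b"
    using class_nonempty ab by blast
  note X = finite_gset_member[OF ab(1) XY(1)] and Y = finite_gset_member[OF ab(2) XY(2)]
  define e where "e L = int (card {x \<in> fst X. stabilizer G (snd X) x = L}) -
    int (card {y \<in> fst Y. stabilizer G (snd Y) y = L})" for L
  show thesis
  proof (rule that[of e])
    fix K assume K: "subgroup K G"
    have "mark G K x = int (card (fixed_points K X)) - int (card (fixed_points K Y))"
      using ab K XY by (simp add: mark_groth_class class_mark_member)
    then show "mark G K x = (\<Sum>L | subgroup L G \<and> K \<subseteq> L. e L)"
      using card_fixed_points_strata[OF X subgroup.subset[OF K]]
        card_fixed_points_strata[OF Y subgroup.subset[OF K]]
      by (simp add: e_def sum_subtractf)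
  next
    fix L assume "L \<lhd> G"
    then show "int (subgroup_index G L) dvd e L"
      unfolding e_def by (intro dvd_diff) (simp_all add: index_dvd_card_stabilizer_eq X Y)
  qed
qed

text \<open>Write the mark at \<open>D\<close> as a sum over the subgroups \<open>L \<supseteq> D\<close> with terms divisible by
  \<open>|G : L|\<close>. By induction the terms for \<open>L \<supset> D\<close> other than \<open>M\<close> and \<open>G\<close> vanish. Those of \<open>M\<close> and \<open>G\<close> add up to
  the mark at \<open>M\<close> or, if \<open>D\<close> is not contained in \<open>M\<close>, at \<open>G\<close>. So if \<open>D\<close> is neither \<open>M\<close> nor \<open>G\<close>, its own term
  is a difference of two marks of a unit, thus \<open>0\<close> or \<open>\<plusminus>2\<close>. Being divisible by \<open>|G : D| \<ge> 3\<close>, it is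
  \<open>0\<close>.\<close>

lemma unit_marks_normal_subgroups:
  assumes norm: "\<And>L. subgroup L G \<Longrightarrow> L \<lhd> G"
    and M: "subgroup M G" "\<And>L. subgroup L G \<Longrightarrow> subgroup_index G L = 2 \<longleftrightarrow> L = M"
    and x: "x \<in> Units \<Omega>" and D: "subgroup D G"
  shows "mark G D x = (if D \<subseteq> M then mark G M x else mark G (carrier G) x)"
proof -
  have xR: "x \<in> carrier \<Omega>"
    using x by blast
  obtain e where e: "\<And>K. subgroup K G \<Longrightarrow> mark G K x = (\<Sum>L | subgroup L G \<and> K \<subseteq> L. e L)"
    and dvd: "\<And>L. L \<lhd> G \<Longrightarrow> int (subgroup_index G L) dvd e L"
    using mark_strata[OF xR] by blast
  define U where "U = {L. subgroup L G}"
  have finU: "finite U"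
    unfolding U_def
    by (rule finite_subset[of _ "Pow (carrier G)"]) (auto dest: subgroup.subset)
  have index_M: "subgroup_index G M = 2"
    using M by blast
  have GM: "\<not> carrier G \<subseteq> M" "carrier G \<noteq> M"
    using index_M subgroup_index_carrier subgroup.subset[OF M(1)] by auto
  have large: "subgroup_index G L \<ge> 3" if "subgroup L G" "L \<noteq> M" "L \<noteq> carrier G" for L
    using that M(2) subgroup_eq_carrier_iff index_pos[OF that(1)] by (metis Suc_1 eval_nat_numeral(3)
        le_antisym not_less_eq_eq One_nat_def Suc_leI)
  \<comment> \<open>The contribution of \<open>M\<close> and \<open>G\<close> to the mark at \<open>K\<close>.\<close>
  define r where "r K = (if K \<subseteq> M then e M else 0) + e (carrier G)" for K
  have split: "mark G K x = (if K \<in> {M, carrier G} then 0 else e K) + r K"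
    if K: "subgroup K G" and 0: "\<And>L. subgroup L G \<Longrightarrow> K \<subset> L \<Longrightarrow> L \<notin> {M, carrier G} \<Longrightarrow> e L = 0"
    for K
  proof -
    have KG: "K \<subseteq> carrier G"
      by (rule subgroup.subset[OF K])
    let ?V = "insert K (insert (carrier G) (if K \<subseteq> M then {M} else {}))"
    have "mark G K x = sum e ?V"
      unfolding e[OF K] using finU K KG M(1) subgroup_self 0
      by (intro sum.mono_neutral_right) (auto simp: U_def split: if_splits)
    also have "\<dots> = (if K \<in> {M, carrier G} then 0 else e K) + r K"
      using KG GM by (auto simp: r_def insert_absorb)
    finally show ?thesis .
  qed
  have zero: "e K = 0" if "subgroup K G" "K \<notin> {M, carrier G}" for K
    using that
  proof (induction "order G - card K" arbitrary: K rule: less_induct)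
    case less
    have above: "e L = 0" if "subgroup L G" "K \<subset> L" "L \<notin> {M, carrier G}" for L
    proof (rule less.hyps)
      have "card K < card L"
        using that by (intro psubset_card_mono) simp_all
      moreover have "card L \<le> order G"
        using that(1) by (simp add: order_def card_mono subgroup.subset)
      ultimately show "order G - card L < order G - card K"
        by simp
    qed (use that in auto)
    have aboveM: "e L = 0" if "subgroup L G" "M \<subset> L" "L \<notin> {M, carrier G}" for L
    proof -
      have "card M < card L"
        using that by (intro psubset_card_mono) simp_all
      moreover have "subgroup_index G L * card L = 2 * card M" "subgroup_index G L \<ge> 3"
        using that subgroup_index_mult_card[OF M(1)] subgroup_index_mult_card[OF that(1)] large index_M
        by auto
      ultimately have "3 * card L \<le> 2 * card M" "card M < card L"
        by (metis mult_le_mono1, simp)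
      then show ?thesis by simp
    qed
    have split_G: "mark G (carrier G) x = e (carrier G)"
    proof -
      have "mark G (carrier G) x = (if carrier G \<in> {M, carrier G} then 0 else e (carrier G)) + r (carrier G)"
        by (rule split[OF subgroup_self]) (auto dest: subgroup.subset)
      then show ?thesis
        using GM by (simp add: r_def)
    qed
    have rK: "r K = mark G M x \<or> r K = mark G (carrier G) x"
    proof (cases "K \<subseteq> M")
      case True
      then show ?thesis
        using split[OF M(1) aboveM] by (simp add: r_def)
    next
      case False
      then show ?thesis
        using split_G by (simp add: r_def)
    qed
    have "e K = mark G K x - r K"
      using split[OF less.prems(1) above] less.prems(2) by simp
    then have "\<bar>e K\<bar> \<le> 2"
      using rK mark_unit[OF x less.prems(1)] mark_unit[OF x M(1)] mark_unit[OF x subgroup_self]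
      by auto
    moreover have "int (subgroup_index G K) \<ge> 3"
      using large[OF less.prems(1)] less.prems(2) by simp
    ultimately show ?case
      using dvd_imp_le_int[OF _ dvd[OF norm[OF less.prems(1)]]] by fastforce
  qed
  have marks: "mark G K x = r K" if K: "subgroup K G" for K
  proof -
    have "mark G K x = (if K \<in> {M, carrier G} then 0 else e K) + r K"
      by (rule split[OF K zero])
    then show ?thesis
      using zero[OF K] by (simp split: if_splits)
  qed
  show ?thesis
    unfolding marks[OF D] marks[OF M(1)] marks[OF subgroup_self] using GM by (simp add: r_def)
qed

end

section \<open>The span of the classes \<open>[G/N]\<close>, \<open>N\<close> normal\<close>

context finite_group
begin

lemma mark_coset_normal:
  assumes "N \<lhd> G" "subgroup K G"
  shows "mark G K (burnside_class G (coset_gset G N)) =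
    (if K \<subseteq> N then int (subgroup_index G N) else 0)"
  using assms finite_gset_coset[OF normal_imp_subgroup[OF assms(1)]]
  by (simp add: mark_burnside_class card_fixed_points_coset_normal)

lemma coset_class_closed: "subgroup H G \<Longrightarrow> burnside_class G (coset_gset G H) \<in> carrier \<Omega>"
  by (simp add: burnside_class_closed finite_gset_coset)

text \<open>In \<open>G/M \<times> G/N\<close> every point has stabilizer \<open>M \<inter> N\<close>.\<close>

lemma index_inter_dvd:
  assumes M: "M \<lhd> G" and N: "N \<lhd> G"
  shows "subgroup_index G (M \<inter> N) dvd subgroup_index G M * subgroup_index G N"
proof -
  have MN: "M \<inter> N \<lhd> G"
    using normal_subgroup_intersect[OF M N] .
  note sub = normal_imp_subgroup[OF M] normal_imp_subgroup[OF N] normal_imp_subgroup[OF MN]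
  let ?X = "gset_prod (coset_gset G M) (coset_gset G N)"
  have X: "finite_gset G ?X"
    by (intro finite_gset_prod finite_gset_coset sub)
  have fixed: "card (fixed_points K ?X) =
      (if K \<subseteq> M \<inter> N then subgroup_index G M * subgroup_index G N else 0)" if "subgroup K G" for K
    using that M N sub
    by (simp add: card_fixed_points_prod finite_gset_coset subgroup.subset card_fixed_points_coset_normal)
  have "stabilizer G (snd ?X) x = M \<inter> N"
    if x: "x \<in> fst ?X" and "M \<inter> N \<subseteq> stabilizer G (snd ?X) x" for x
  proof -
    let ?H = "stabilizer G (snd ?X) x"
    have H: "subgroup ?H G"
      by (rule stabilizer_is_subgroup[OF X x])
    have "x \<in> fixed_points ?H ?X"
      using x by (simp add: mem_fixed_points_iff[OF subgroup.subset[OF H]])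
    then have "card (fixed_points ?H ?X) \<noteq> 0"
      using finite_fixed_points[OF X] by auto
    then show ?thesis
      using fixed[OF H] that(2) by (auto split: if_splits)
  qed
  then have "{x \<in> fst ?X. stabilizer G (snd ?X) x = M \<inter> N} = fixed_points (M \<inter> N) ?X"
    using mem_fixed_points_iff[OF subgroup.subset[OF sub(3)], of _ ?X] by blast
  then show ?thesis
    using index_dvd_card_stabilizer_eq[OF X MN] fixed[OF sub(3)] by simp
qed

abbreviation (input) "normal_span \<equiv> carrier (burnside_subring G (normal_subgroups G))"

lemma span_eq:
  "normal_span = generate (add_monoid \<Omega>) {burnside_class G (coset_gset G N) | N. N \<lhd> G}"
  by (simp add: burnside_subring_def normal_subgroups_def)

lemma span_additive_subgroup: "subgroup normal_span (add_monoid \<Omega>)"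
  unfolding span_eq
  by (rule burnside.add.generate_is_subgroup) (auto intro: coset_class_closed normal_imp_subgroup)

lemma coset_class_in_span: "N \<lhd> G \<Longrightarrow> burnside_class G (coset_gset G N) \<in> normal_span"
  unfolding span_eq by (rule generate.incl) blast

lemma
  shows span_subset: "x \<in> normal_span \<Longrightarrow> x \<in> carrier \<Omega>"
    and span_zero: "\<zero>\<^bsub>\<Omega>\<^esub> \<in> normal_span"
    and span_add: "x \<in> normal_span \<Longrightarrow> y \<in> normal_span \<Longrightarrow> x \<oplus>\<^bsub>\<Omega>\<^esub> y \<in> normal_span"
    and span_uminus: "x \<in> normal_span \<Longrightarrow> \<ominus>\<^bsub>\<Omega>\<^esub> x \<in> normal_span"
  using subgroup.mem_carrier[OF span_additive_subgroup] subgroup.one_closed[OF span_additive_subgroup]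
    subgroup.m_closed[OF span_additive_subgroup] subgroup.m_inv_closed[OF span_additive_subgroup]
  by (simp_all add: a_inv_def)

lemma span_minus: "x \<in> normal_span \<Longrightarrow> y \<in> normal_span \<Longrightarrow> x \<ominus>\<^bsub>\<Omega>\<^esub> y \<in> normal_span"
  by (simp add: a_minus_def span_add span_uminus)

lemma one_eq_coset_class: "\<one>\<^bsub>\<Omega>\<^esub> = burnside_class G (coset_gset G (carrier G))"
  by (rule burnside_eqI)
    (simp_all add: burnside_one_closed coset_class_closed subgroup_self mark_one mark_coset_normal
      carrier_normal subgroup_index_carrier subgroup.subset)

lemma span_one: "\<one>\<^bsub>\<Omega>\<^esub> \<in> normal_span"
  unfolding one_eq_coset_class by (rule coset_class_in_span[OF carrier_normal])

lemma span_add_pow: "x \<in> normal_span \<Longrightarrow> [(n :: nat)] \<cdot>\<^bsub>\<Omega>\<^esub> x \<in> normal_span"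
  by (induction n) (simp_all add: span_zero span_add)

lemma mark_add_pow:
  "x \<in> carrier \<Omega> \<Longrightarrow> subgroup K G \<Longrightarrow> mark G K ([(n :: nat)] \<cdot>\<^bsub>\<Omega>\<^esub> x) = int n * mark G K x"
  by (induction n) (simp_all add: mark_zero mark_add algebra_simps)

text \<open>\<open>G/M \<times> G/N\<close> is a disjoint union of copies of \<open>G/(M \<inter> N)\<close>.\<close>

lemma coset_class_mult_in_span:
  assumes M: "M \<lhd> G" and N: "N \<lhd> G"
  shows "burnside_class G (coset_gset G M) \<otimes>\<^bsub>\<Omega>\<^esub> burnside_class G (coset_gset G N) \<in> normal_span"
proof -
  have MN: "M \<inter> N \<lhd> G"
    using normal_subgroup_intersect[OF M N] .
  note sub = normal_imp_subgroup[OF M] normal_imp_subgroup[OF N] normal_imp_subgroup[OF MN]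
  obtain c where c: "subgroup_index G M * subgroup_index G N = subgroup_index G (M \<inter> N) * c"
    using index_inter_dvd[OF M N] by blast
  have c': "int (subgroup_index G M) * int (subgroup_index G N) = int c * int (subgroup_index G (M \<inter> N))"
    using c by (metis mult.commute of_nat_mult)
  have "burnside_class G (coset_gset G M) \<otimes>\<^bsub>\<Omega>\<^esub> burnside_class G (coset_gset G N) =
      [c] \<cdot>\<^bsub>\<Omega>\<^esub> burnside_class G (coset_gset G (M \<inter> N))"
    by (rule burnside_eqI)
      (simp_all add: coset_class_closed sub mark_mult mark_add_pow mark_coset_normal M N MN c')
  then show ?thesis
    by (simp add: span_add_pow coset_class_in_span MN)
qed

lemma span_mult:
  assumes x: "x \<in> normal_span" and y: "y \<in> normal_span"
  shows "x \<otimes>\<^bsub>\<Omega>\<^esub> y \<in> normal_span"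
proof -
  have minus: "inv\<^bsub>add_monoid \<Omega>\<^esub> z = \<ominus>\<^bsub>\<Omega>\<^esub> z" for z
    by (simp add: a_inv_def)
  have coset: "burnside_class G (coset_gset G M) \<otimes>\<^bsub>\<Omega>\<^esub> z \<in> normal_span" if M: "M \<lhd> G" and z: "z \<in> normal_span" for M z
    using z unfolding span_eq
  proof (induction rule: generate.induct)
    case one
    then show ?case
      using span_zero M by (simp add: coset_class_closed normal_imp_subgroup span_eq)
  next
    case (incl h)
    then show ?case
      using coset_class_mult_in_span[OF M] by (auto simp: span_eq)
  next
    case (inv h)
    then obtain N where N: "N \<lhd> G" "h = burnside_class G (coset_gset G N)"
      by blast
    then have "\<ominus>\<^bsub>\<Omega>\<^esub> (burnside_class G (coset_gset G M) \<otimes>\<^bsub>\<Omega>\<^esub> h) \<in> normal_span"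
      using span_uminus[OF coset_class_mult_in_span[OF M]] by simp
    then have "burnside_class G (coset_gset G M) \<otimes>\<^bsub>\<Omega>\<^esub> (\<ominus>\<^bsub>\<Omega>\<^esub> h) \<in> normal_span"
      using N M by (simp add: burnside.r_minus coset_class_closed normal_imp_subgroup)
    then show ?case
      by (simp only: minus span_eq)
  next
    case (eng h1 h2)
    then have "h1 \<in> carrier \<Omega>" "h2 \<in> carrier \<Omega>"
      using span_subset by (simp_all add: span_eq)
    then show ?case
      using eng.IH span_add M
      by (simp add: burnside.r_distr coset_class_closed normal_imp_subgroup span_eq)
  qed
  have yR: "y \<in> carrier \<Omega>"
    by (rule span_subset[OF y])
  show ?thesis
    using x unfolding span_eq
  proof (induction rule: generate.induct)
    case one
    then show ?case
      using span_zero yR by (simp add: span_eq)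
  next
    case (incl h)
    then show ?case
      using coset y by (auto simp: span_eq)
  next
    case (inv h)
    then obtain N where N: "N \<lhd> G" "h = burnside_class G (coset_gset G N)"
      by blast
    then have "\<ominus>\<^bsub>\<Omega>\<^esub> (h \<otimes>\<^bsub>\<Omega>\<^esub> y) \<in> normal_span"
      using span_uminus[OF coset[OF _ y]] by simp
    then have "(\<ominus>\<^bsub>\<Omega>\<^esub> h) \<otimes>\<^bsub>\<Omega>\<^esub> y \<in> normal_span"
      using N yR by (simp add: burnside.l_minus coset_class_closed normal_imp_subgroup)
    then show ?case
      by (simp only: minus span_eq)
  next
    case (eng h1 h2)
    then have "h1 \<in> carrier \<Omega>" "h2 \<in> carrier \<Omega>"
      using span_subset by (simp_all add: span_eq)
    then show ?case
      using eng.IH span_add yR by (simp add: burnside.l_distr span_eq)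
  qed
qed

lemma involution_in_subring_units:
  "x \<in> normal_span \<Longrightarrow> x \<otimes>\<^bsub>\<Omega>\<^esub> x = \<one>\<^bsub>\<Omega>\<^esub> \<Longrightarrow> x \<in> Units (burnside_subring G (normal_subgroups G))"
  unfolding Units_def by (auto simp: burnside_subring_def)

section \<open>The units \<open>u\<^sub>N\<close>\<close>

lemma burnside_u_closed: "subgroup N G \<Longrightarrow> burnside_u G N \<in> carrier \<Omega>"
  by (simp add: burnside_u_def coset_class_closed)

lemma mark_burnside_u:
  assumes "subgroup N G" "subgroup_index G N = 2" "subgroup K G"
  shows "mark G K (burnside_u G N) = (if K \<subseteq> N then -1 else 1)"
  using assms index_two_imp_normal[OF assms(1,2)]
  by (simp add: burnside_u_def mark_minus mark_one mark_coset_normal coset_class_closed)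

lemma burnside_square_eq_one:
  assumes "x \<in> carrier \<Omega>" "\<And>K. subgroup K G \<Longrightarrow> mark G K x = 1 \<or> mark G K x = -1"
  shows "x \<otimes>\<^bsub>\<Omega>\<^esub> x = \<one>\<^bsub>\<Omega>\<^esub>"
proof (rule burnside_eqI)
  fix K assume "subgroup K G"
  with assms(2)[OF this] show "mark G K (x \<otimes>\<^bsub>\<Omega>\<^esub> x) = mark G K \<one>\<^bsub>\<Omega>\<^esub>"
    by (auto simp: mark_mult mark_one assms(1))
qed (simp_all add: assms(1))

lemma burnside_involution_unit:
  "x \<in> carrier \<Omega> \<Longrightarrow> x \<otimes>\<^bsub>\<Omega>\<^esub> x = \<one>\<^bsub>\<Omega>\<^esub> \<Longrightarrow> x \<in> Units \<Omega>"
  unfolding Units_def by blast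

definition index_two_product where
  "index_two_product = (\<Otimes>\<^bsub>\<Omega>\<^esub>N\<in>{N. subgroup N G \<and> subgroup_index G N = 2}. burnside_u G N)"

lemma finite_index_two: "finite {N. subgroup N G \<and> subgroup_index G N = 2}"
  by (rule finite_subset[of _ "Pow (carrier G)"]) (auto dest: subgroup.subset)

lemma index_two_product_in_span: "index_two_product \<in> normal_span"
proof -
  have "(\<Otimes>\<^bsub>\<Omega>\<^esub>N\<in>A. burnside_u G N) \<in> normal_span"
    if "finite A" "A \<subseteq> {N. subgroup N G \<and> subgroup_index G N = 2}" for A
    using that
  proof (induction A rule: finite_induct)
    case (insert N A)
    then have N: "subgroup N G" "subgroup_index G N = 2" and A: "\<And>M. M \<in> A \<Longrightarrow> subgroup M G"
      by auto
    have "burnside_u G N \<in> normal_span"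
      unfolding burnside_u_def
      by (intro span_minus span_one coset_class_in_span index_two_imp_normal N)
    then show ?case
      using insert N A by (simp add: burnside.finprod_insert Pi_iff burnside_u_closed span_mult)
  qed (simp add: span_one)
  then show ?thesis
    unfolding index_two_product_def using finite_index_two by blast
qed

lemma even_index_of_subset:
  assumes "subgroup K G" "subgroup N G" "K \<subseteq> N" "even (subgroup_index G N)"
  shows "even (subgroup_index G K)"
proof -
  obtain d where "card N = card K * d"
    using card_subgroup_dvd[OF assms(1-3)] by blast
  then have "subgroup_index G K * card K = (subgroup_index G N * d) * card K"
    using subgroup_index_mult_card[OF assms(1)] subgroup_index_mult_card[OF assms(2)]
    by (metis mult.assoc mult.commute)
  then have "subgroup_index G K = subgroup_index G N * d"
    using card_subgroup_pos[OF assms(1)] by simp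
  then show ?thesis
    using assms(4) by simp
qed

text \<open>The mark at \<open>K\<close> is \<open>(-1)\<^sup>m\<close>, where \<open>m\<close> is the number of index-two subgroups containing \<open>K\<close>.
  This number is odd by hypothesis if \<open>|G : K|\<close> is even, and it is zero otherwise.\<close>

lemma mark_index_two_product:
  assumes semi: "seminilpotent 2 1 G" and K: "subgroup K G"
  shows "mark G K index_two_product = (if even (subgroup_index G K) then -1 else 1)"
proof -
  let ?I = "{N. subgroup N G \<and> subgroup_index G N = 2}"
  have J: "{N \<in> ?I. K \<subseteq> N} = {N. N \<lhd> G \<and> K \<subseteq> N \<and> subgroup_index G N = 2 ^ 1}"
    using index_two_imp_normal normal_imp_subgroup by auto
  have "mark G K index_two_product = (\<Prod>N\<in>?I. mark G K (burnside_u G N))"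
    unfolding index_two_product_def
    by (rule mark_finprod[OF finite_index_two _ K]) (auto intro: burnside_u_closed)
  also have "\<dots> = (\<Prod>N\<in>?I. if K \<subseteq> N then -1 else 1)"
    by (rule prod.cong) (auto simp: mark_burnside_u K)
  also have "\<dots> = (-1) ^ card {N \<in> ?I. K \<subseteq> N}"
    using finite_index_two by (simp add: prod.If_cases Int_def)
  also have "\<dots> = (if even (subgroup_index G K) then -1 else 1)"
  proof (cases "even (subgroup_index G K)")
    case True
    then have "[card {N \<in> ?I. K \<subseteq> N} = 1] (mod 2)"
      using semi K unfolding J seminilpotent_def by simp
    then have "odd (card {N \<in> ?I. K \<subseteq> N})"
      by (simp add: cong_def odd_iff_mod_2_eq_one)
    then show ?thesis
      using True by simp
  next
    case False
    then have "\<not> K \<subseteq> N" if "subgroup N G" "subgroup_index G N = 2" for N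
      using even_index_of_subset[OF K that(1)] that(2) by auto
    then have "{N \<in> ?I. K \<subseteq> N} = {}"
      by blast
    then show ?thesis
      using False by (simp only: card.empty) simp
  qed
  finally show ?thesis .
qed

lemma generate_neg_one_involution:
  assumes u: "u \<in> carrier \<Omega>" "u \<otimes>\<^bsub>\<Omega>\<^esub> u = \<one>\<^bsub>\<Omega>\<^esub>"
  shows "generate (units_of \<Omega>) {\<ominus>\<^bsub>\<Omega>\<^esub> \<one>\<^bsub>\<Omega>\<^esub>, u} =
    {\<one>\<^bsub>\<Omega>\<^esub>, \<ominus>\<^bsub>\<Omega>\<^esub> \<one>\<^bsub>\<Omega>\<^esub>, u, \<ominus>\<^bsub>\<Omega>\<^esub> u}"
    (is "?L = ?S")
proof
  let ?m = "\<ominus>\<^bsub>\<Omega>\<^esub> \<one>\<^bsub>\<Omega>\<^esub>"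
  have m: "?m \<in> carrier \<Omega>" "?m \<otimes>\<^bsub>\<Omega>\<^esub> ?m = \<one>\<^bsub>\<Omega>\<^esub>" "?m \<otimes>\<^bsub>\<Omega>\<^esub> u = \<ominus>\<^bsub>\<Omega>\<^esub> u"
    using u by (simp_all add: burnside.l_minus)
  have inv: "inv\<^bsub>units_of \<Omega>\<^esub> x = x" if "x \<in> {?m, u}" for x
  proof -
    have x: "x \<in> carrier \<Omega>" "x \<otimes>\<^bsub>\<Omega>\<^esub> x = \<one>\<^bsub>\<Omega>\<^esub>"
      using that u m by auto
    then have "inv\<^bsub>\<Omega>\<^esub> x = x"
      by (intro burnside.comm_inv_char) auto
    then show ?thesis
      using burnside.units_of_inv burnside_involution_unit[OF x] by simp
  qed
  show "?L \<subseteq> ?S"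
  proof
    fix x assume "x \<in> ?L"
    then show "x \<in> ?S"
    proof (induction rule: generate.induct)
      case (eng x y)
      from eng.IH show ?case
        by (elim insertE emptyE)
          (simp_all add: units_of_mult u burnside.l_minus burnside.r_minus)
    qed (use inv in \<open>auto simp: units_of_one\<close>)
  qed
  have "\<ominus>\<^bsub>\<Omega>\<^esub> u \<in> ?L"
    using generate.eng[OF generate.incl[of ?m] generate.incl[of u], of "{?m, u}" "units_of \<Omega>"] m(3)
    by (simp add: units_of_mult)
  then show "?S \<subseteq> ?L"
    using generate.one[of "units_of \<Omega>"] by (auto intro: generate.incl simp: units_of_one)
qed

end

section \<open>Units of the Burnside ring of a cyclic group and their images\<close>

context finite_group
begin

lemma index_two_of_cyclic:
  assumes cyc: "cyclic_group G" and "even (order G)"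
  defines "M \<equiv> {x \<in> carrier G. x [^] (order G div 2) = \<one>}"
  shows "subgroup M G"
    and "\<And>L. subgroup L G \<Longrightarrow> subgroup_index G L = 2 \<longleftrightarrow> L = M"
    and "\<And>L. subgroup L G \<Longrightarrow> L \<subseteq> M \<longleftrightarrow> even (subgroup_index G L)"
proof -
  have n: "order G = 2 * (order G div 2)" "order G div 2 dvd order G" "order G div 2 > 0"
    using assms(2) order_gt_0_iff_finite fin by (auto elim!: evenE)
  show M: "subgroup M G"
    unfolding M_def by (rule torsion_is_subgroup[OF cyc n(2)])
  have cardM: "card M = order G div 2"
    unfolding M_def by (rule card_torsion[OF cyc n(2)])
  fix L assume L: "subgroup L G"
  have index: "subgroup_index G L * card L = order G"
    by (rule subgroup_index_mult_card[OF L])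
  show "subgroup_index G L = 2 \<longleftrightarrow> L = M"
  proof
    assume "subgroup_index G L = 2"
    then have "card L = order G div 2"
      using index by simp
    then show "L = M"
      using cyclic_subgroup_eq_torsion[OF cyc L] by (simp add: M_def)
  next
    assume "L = M"
    then have "subgroup_index G L * (order G div 2) = 2 * (order G div 2)"
      using index cardM n(1) by simp
    then show "subgroup_index G L = 2"
      using n(3) by simp
  qed
  have "L \<subseteq> M \<longleftrightarrow> card L dvd order G div 2"
    using torsion_mono_iff[OF cyc, of "card L" "order G div 2"] index
      cyclic_subgroup_eq_torsion[OF cyc L] dvd_triv_right[of "card L"]
    unfolding M_def by metis
  also have "\<dots> \<longleftrightarrow> 2 * card L dvd 2 * (order G div 2)"
    by simp
  also have "\<dots> \<longleftrightarrow> 2 * card L dvd subgroup_index G L * card L"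
    using n(1) index by simp
  also have "\<dots> \<longleftrightarrow> even (subgroup_index G L)"
    using card_subgroup_pos[OF L] by simp
  finally show "L \<subseteq> M \<longleftrightarrow> even (subgroup_index G L)" .
qed

lemma cyclic_imp_normal:
  assumes "cyclic_group G" "subgroup H G"
  shows "H \<lhd> G"
  using comm_group.normal_iff_subgroup[OF cyclic_imp_abelian_group[OF assms(1)]] assms(2) by blast

end

theorem theorem6p5:
  fixes G :: "('a, 'm) monoid_scheme" and C :: "('b, 'n) monoid_scheme"
    and n :: nat and \<alpha> :: "'b burnside \<Rightarrow> 'a burnside"
  assumes "group G" "finite (carrier G)" "order G = n" "even n"
    and "group C" "cyclic_group C" "order C = n"
    and "frobenius_wielandt C G \<alpha>"
    and "seminilpotent 2 1 G"
  shows "\<alpha> ` Units (burnside_ring C) \<subseteq> Units (burnside_subring G (normal_subgroups G)) \<and>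
    \<alpha> ` Units (burnside_ring C) =
      generate (units_of (burnside_ring G))
        {\<ominus>\<^bsub>burnside_ring G\<^esub> \<one>\<^bsub>burnside_ring G\<^esub>,
         \<Otimes>\<^bsub>burnside_ring G\<^esub>N\<in>{N. subgroup N G \<and> subgroup_index G N = 2}. burnside_u G N}"
proof -
  interpret G: finite_group G
    using assms(1,2) by (simp add: finite_group_def finite_group_axioms_def)
  have "order C > 0"
    using assms(3,7) G.order_gt_0_iff_finite by simp
  then have "finite (carrier C)"
    by (simp add: order_def card_gt_0_iff)
  then interpret C: finite_group C
    using assms(5) by (simp add: finite_group_def finite_group_axioms_def)
  let ?RC = "burnside_ring C" and ?RG = "burnside_ring G"
  let ?P = "carrier (burnside_subring G (normal_subgroups G))"
  let ?u = "G.index_two_product"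
  define M where "M = {x \<in> carrier C. x [^]\<^bsub>C\<^esub> (order C div 2) = \<one>\<^bsub>C\<^esub>}"
  have even: "even (order C)"
    using assms(4,7) by simp
  note M = C.index_two_of_cyclic[OF assms(6) even, folded M_def]
  have index_M: "subgroup_index C M = 2"
    using M(1,2) by blast
  have hom: "\<alpha> \<in> ring_hom ?RC ?RG"
    and \<alpha>_mark: "\<And>K x. subgroup K G \<Longrightarrow> x \<in> carrier ?RC \<Longrightarrow>
      mark G K (\<alpha> x) = mark C (subgroup_of_order C (card K)) x"
    using assms(8) by (auto simp: frobenius_wielandt_def)
  \<comment> \<open>The subgroup of \<open>C\<close> of order \<open>|K|\<close> has the same index in \<open>C\<close> as \<open>K\<close> has in \<open>G\<close>.\<close>
  have corr: "subgroup (subgroup_of_order C (card K)) C \<and>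
      (subgroup_of_order C (card K) \<subseteq> M \<longleftrightarrow> even (subgroup_index G K))"
    if K: "subgroup K G" for K
  proof -
    let ?D = "subgroup_of_order C (card K)"
    have dvd: "card K dvd order C"
      using G.subgroup_index_mult_card[OF K] assms(3,7) by (metis dvd_triv_right)
    have D: "subgroup ?D C" "card ?D = card K"
      using C.torsion_is_subgroup[OF assms(6) dvd] C.card_torsion[OF assms(6) dvd]
      by (simp_all add: C.subgroup_of_order_cyclic[OF assms(6) dvd])
    have "subgroup_index C ?D * card K = subgroup_index G K * card K"
      using C.subgroup_index_mult_card[OF D(1)] G.subgroup_index_mult_card[OF K] D(2) assms(3,7)
      by simp
    then have "subgroup_index C ?D = subgroup_index G K"
      using G.card_subgroup_pos[OF K] by simp
    then show ?thesis
      using D(1) M(3) by simp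
  qed
  have u: "?u \<in> carrier ?RG"
    by (rule G.span_subset[OF G.index_two_product_in_span])
  note u_mark = G.mark_index_two_product[OF assms(9)]
  have u2: "?u \<otimes>\<^bsub>?RG\<^esub> ?u = \<one>\<^bsub>?RG\<^esub>"
    using u by (rule G.burnside_square_eq_one) (simp add: u_mark)
  let ?S = "{\<one>\<^bsub>?RG\<^esub>, \<ominus>\<^bsub>?RG\<^esub> \<one>\<^bsub>?RG\<^esub>, ?u, \<ominus>\<^bsub>?RG\<^esub> ?u}"
  have image_sub: "\<alpha> ` Units ?RC \<subseteq> ?S"
  proof
    fix y assume "y \<in> \<alpha> ` Units ?RC"
    then obtain x where x: "x \<in> Units ?RC" "y = \<alpha> x"
      by blast
    then have xC: "x \<in> carrier ?RC"
      by blast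
    have y: "y \<in> carrier ?RG"
      using ring_hom_closed[OF hom xC] x(2) by simp
    have y_mark: "mark G K y = (if even (subgroup_index G K) then mark C M x else mark C (carrier C) x)"
      if K: "subgroup K G" for K
      using C.unit_marks_normal_subgroups[OF C.cyclic_imp_normal[OF assms(6)] M(1,2) x(1)]
        corr[OF K] \<alpha>_mark[OF K xC] x(2) by simp
    \<comment> \<open>So \<open>y\<close> is determined by two signs, which leaves the four elements of \<open>?S\<close>.\<close>
    have cases: "mark C M x = 1 \<or> mark C M x = -1" "mark C (carrier C) x = 1 \<or> mark C (carrier C) x = -1"
      using C.mark_unit[OF x(1)] M(1) C.subgroup_self by blast+
    have eq: "y = z" if "z \<in> carrier ?RG" "\<And>K. subgroup K G \<Longrightarrow>
        mark G K z = (if even (subgroup_index G K) then mark C M x else mark C (carrier C) x)" for z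
      using that by (intro G.burnside_eqI[OF y]) (simp_all add: y_mark)
    have "y = \<one>\<^bsub>?RG\<^esub>" if "mark C M x = 1" "mark C (carrier C) x = 1"
      by (rule eq) (simp_all add: that G.mark_one)
    moreover have "y = \<ominus>\<^bsub>?RG\<^esub> \<one>\<^bsub>?RG\<^esub>" if "mark C M x = -1" "mark C (carrier C) x = -1"
      by (rule eq) (simp_all add: that G.mark_one G.mark_uminus)
    moreover have "y = ?u" if "mark C M x = -1" "mark C (carrier C) x = 1"
      by (rule eq) (simp_all add: that u u_mark)
    moreover have "y = \<ominus>\<^bsub>?RG\<^esub> ?u" if "mark C M x = 1" "mark C (carrier C) x = -1"
      by (rule eq) (simp_all add: that u u_mark G.mark_uminus)
    ultimately show "y \<in> ?S"
      using cases by auto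
  qed
  have "?S \<subseteq> \<alpha> ` Units ?RC"
  proof -
    define v where "v = burnside_u C M"
    have v: "v \<in> carrier ?RC"
      unfolding v_def by (rule C.burnside_u_closed[OF M(1)])
    have v_mark: "mark C D v = (if D \<subseteq> M then -1 else 1)" if "subgroup D C" for D
      unfolding v_def by (rule C.mark_burnside_u[OF M(1) index_M that])
    have "v \<otimes>\<^bsub>?RC\<^esub> v = \<one>\<^bsub>?RC\<^esub>"
      using v by (rule C.burnside_square_eq_one) (simp add: v_mark)
    then have vU: "v \<in> Units ?RC"
      by (rule C.burnside_involution_unit[OF v])
    have neg_unit: "\<ominus>\<^bsub>?RC\<^esub> x \<in> Units ?RC" if "x \<in> Units ?RC" for x
    proof -
      have "\<ominus>\<^bsub>?RC\<^esub> x = \<ominus>\<^bsub>?RC\<^esub> \<one>\<^bsub>?RC\<^esub> \<otimes>\<^bsub>?RC\<^esub> x"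
        using C.burnside.Units_closed[OF that] by (simp add: C.burnside.l_minus)
      then show ?thesis
        using C.burnside.Units_m_closed[OF C.burnside.Units_minus_one_closed that] by simp
    qed
    have \<alpha>_one: "\<alpha> \<one>\<^bsub>?RC\<^esub> = \<one>\<^bsub>?RG\<^esub>"
      using ring_hom_one[OF hom] .
    interpret \<alpha>: ring_hom_ring ?RC ?RG \<alpha>
      by (rule ring_hom_ringI2[OF C.burnside.ring_axioms G.burnside.ring_axioms hom])
    have \<alpha>_v: "\<alpha> v = ?u"
    proof (rule G.burnside_eqI)
      fix K assume K: "subgroup K G"
      show "mark G K (\<alpha> v) = mark G K ?u"
        using corr[OF K] by (simp add: \<alpha>_mark[OF K v] v_mark u_mark[OF K])
    qed (simp_all add: u v)
    have "\<one>\<^bsub>?RG\<^esub> = \<alpha> \<one>\<^bsub>?RC\<^esub>" "\<ominus>\<^bsub>?RG\<^esub> \<one>\<^bsub>?RG\<^esub> = \<alpha> (\<ominus>\<^bsub>?RC\<^esub> \<one>\<^bsub>?RC\<^esub>)" "?u = \<alpha> v"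
      "\<ominus>\<^bsub>?RG\<^esub> ?u = \<alpha> (\<ominus>\<^bsub>?RC\<^esub> v)"
      using v by (simp_all add: \<alpha>_v)
    then show ?thesis
      using vU neg_unit C.burnside.Units_one_closed by blast
  qed
  with image_sub have image: "\<alpha> ` Units ?RC = ?S"
    by blast
  have "?S \<subseteq> Units (burnside_subring G (normal_subgroups G))"
  proof
    fix x assume "x \<in> ?S"
    then have "x \<in> ?P" "x \<otimes>\<^bsub>?RG\<^esub> x = \<one>\<^bsub>?RG\<^esub>"
      using u u2 G.span_one G.span_uminus G.index_two_product_in_span
      by (auto simp: G.burnside.l_minus G.burnside.r_minus)
    then show "x \<in> Units (burnside_subring G (normal_subgroups G))"
      by (rule G.involution_in_subring_units)
  qed
  moreover have "generate (units_of ?RG) {\<ominus>\<^bsub>?RG\<^esub> \<one>\<^bsub>?RG\<^esub>, ?u} = ?S"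
    using u u2 by (rule G.generate_neg_one_involution)
  ultimately show ?thesis
    unfolding image G.index_two_product_def by blast
qed

end
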